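(* Let $\{X_n\}$ be a Harris recurrent Markov chain on $\mathscr{X}$ that is $\psi$-irreducible, aperiodic and Feller, and such that the support of $\psi$ has nonempty interior. Then $\{X_n\}$ is non-strongly ergodic (i.e. not strongly ergodic) if and only if there exist a set $A\in\mathscr{B}^+(\mathscr{X})$ and a sequence of functions $V^{(n)}:\mathscr{X}\to\mathbb{R}$, $n\ge1$, satisfying: (1) $\sup_{x\in A^c}V^{(n)}(x)<\infty$ for all $n\ge1$, and $V^{(n)}(x)=0$ for all $x\in A$ and $n\ge1$; (2) $PV^{(n)}(x)\ge V^{(n)}(x)-1$ for all $x\in A^c$ and $n\ge1$; (3) $\sup_{x\in A^c,\ n\ge1}V^{(n)}(x)=\infty$.
   Context: $\mathscr{X}$ is a locally compact separable metric space with a countably generated $\sigma$-field $\mathscr{B}(\mathscr{X})$. $\{X_n\}_{n\ge0}$ is a homogeneous Markov chain on $\mathscr{X}$ with $n$-step kernels $P^n(x,A)=\mathbb{P}(X_n\in A\mid X_0=x)$, $P=P^1$, and $Pf(x)=\int_{\mathscr{X}}f(y)P(x,\mathrm{d}y)$ for measurable $f$. The chain is $\psi$-irreducible if there is a $\sigma$-finite measure $\psi$ on $(\mathscr{X},\mathscr{B}(\mathscr{X}))$ such that $\sum_{n\ge1}P^n(x,A)>0$ for all $x\in\mathscr{X}$ whenever $\psi(A)>0$; throughout, $\psi$ is a maximal irreducibility measure (every irreducibility measure is absolutely continuous with respect to $\psi$), and $\mathscr{B}^+(\mathscr{X})=\{A\in\mathscr{B}(\mathscr{X}):\psi(A)>0\}$.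 Aperiodic and (weak) Feller have the standard meaning of Meyn-Tweedie. Functions are $\mathscr{B}(\mathscr{X})$-measurable. A set $C\in\mathscr{B}(\mathscr{X})$ is petite if there are a probability distribution $\{a_n\}$ on $\mathbb{Z}_+$ and a non-trivial measure $\nu_a$ on $\mathscr{B}(\mathscr{X})$ with $\sum_{n\ge0}a_nP^n(x,B)\ge\nu_a(B)$ for all $x\in C$, $B\in\mathscr{B}(\mathscr{X})$. $\tau_A^+=\inf\{n\ge1:X_n\in A\}$. Harris recurrent: $\mathbb{P}_x(\sum_{n\ge1}\mathbf{1}_{\{X_n\in A\}}=\infty)=1$ for all $x\in\mathscr{X}$, $A\in\mathscr{B}^+(\mathscr{X})$. Strongly (uniformly) ergodic: there is a petite set $C\in\mathscr{B}(\mathscr{X})$ with $\sup_{x\in\mathscr{X}}\mathbb{E}_x\tau_C^+<\infty$; in this case $\sup_{x\in\mathscr{X}}\mathbb{E}_x\tau_A^+<\infty$ for every $A\in\mathscr{B}^+(\mathscr{X})$. *)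

theory Defs
  imports "HOL-Probability.Probability"
begin

text \<open>
  A chain is given by a process \<open>X\<close> on some measurable space together with the
  family \<open>Pr\<close> of its laws, \<open>Pr x\<close> being the law of the chain started at \<open>x\<close>.
\<close>

definition n_step_kernel ::
    "('a::topological_space \<Rightarrow> 'w measure) \<Rightarrow> (nat \<Rightarrow> 'w \<Rightarrow> 'a) \<Rightarrow> nat \<Rightarrow> 'a \<Rightarrow> 'a measure" where
  "n_step_kernel Pr X n x = distr (Pr x) borel (X n)"

text \<open>The \<open>\<sigma>\<close>-field generated by \<open>X 0, \<dots>, X n\<close>.\<close>

definition past :: "'w set \<Rightarrow> (nat \<Rightarrow> 'w \<Rightarrow> 'a::topological_space) \<Rightarrow> nat \<Rightarrow> 'w set set" where
  "past \<Omega> X n = sigma_sets \<Omega> {X i -` B \<inter> \<Omega> | i B. i \<le> n \<and> B \<in> sets borel}"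

text \<open>
  The last clause is the Markov property
  \<open>Pr x (X (n + 1) \<in> A | past n) = P (X n, A)\<close> almost surely, integrated over
  the events \<open>F\<close> of the past.
\<close>

definition markov_chain ::
    "('a::topological_space \<Rightarrow> 'w measure) \<Rightarrow> (nat \<Rightarrow> 'w \<Rightarrow> 'a) \<Rightarrow> bool" where
  "markov_chain Pr X \<longleftrightarrow>
    (\<forall>x. prob_space (Pr x)) \<and>
    (\<forall>x y. sets (Pr x) = sets (Pr y)) \<and>
    (\<forall>x n. X n \<in> measurable (Pr x) borel) \<and>
    (\<forall>x. AE \<omega> in Pr x. X 0 \<omega> = x) \<and>
    n_step_kernel Pr X 1 \<in> measurable borel (subprob_algebra borel) \<and>
    (\<forall>x n. \<forall>F\<in>past (space (Pr x)) X n. \<forall>A\<in>sets borel.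
      emeasure (Pr x) {\<omega>\<in>F. X (Suc n) \<omega> \<in> A} =
        (\<integral>\<^sup>+\<omega>\<in>F. emeasure (n_step_kernel Pr X 1 (X n \<omega>)) A \<partial>Pr x))"

definition irreducibility_measure ::
    "('a::topological_space \<Rightarrow> 'w measure) \<Rightarrow> (nat \<Rightarrow> 'w \<Rightarrow> 'a) \<Rightarrow> 'a measure \<Rightarrow> bool" where
  "irreducibility_measure Pr X \<phi> \<longleftrightarrow>
    sets \<phi> = sets borel \<and> sigma_finite_measure \<phi> \<and>
    (\<forall>A\<in>sets borel. emeasure \<phi> A > 0 \<longrightarrow>
      (\<forall>x. (\<Sum>n. emeasure (n_step_kernel Pr X (Suc n) x) A) > 0))"

text \<open>\<open>absolutely_continuous \<psi> \<phi>\<close> says that every \<open>\<psi>\<close>-null set is \<open>\<phi>\<close>-null.\<close>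

definition maximal_irreducibility_measure ::
    "('a::topological_space \<Rightarrow> 'w measure) \<Rightarrow> (nat \<Rightarrow> 'w \<Rightarrow> 'a) \<Rightarrow> 'a measure \<Rightarrow> bool" where
  "maximal_irreducibility_measure Pr X \<psi> \<longleftrightarrow>
    irreducibility_measure Pr X \<psi> \<and>
    (\<forall>\<phi>. irreducibility_measure Pr X \<phi> \<longrightarrow> absolutely_continuous \<psi> \<phi>)"

definition positive_sets :: "'a::topological_space measure \<Rightarrow> 'a set set" where
  "positive_sets \<psi> = {A \<in> sets borel. emeasure \<psi> A > 0}"

definition measure_support :: "'a::topological_space measure \<Rightarrow> 'a set" where
  "measure_support \<psi> = {x. \<forall>U. open U \<and> x \<in> U \<longrightarrow> emeasure \<psi> U > 0}"

definition is_cycle ::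
    "('a::topological_space \<Rightarrow> 'w measure) \<Rightarrow> (nat \<Rightarrow> 'w \<Rightarrow> 'a) \<Rightarrow> 'a measure \<Rightarrow>
      nat \<Rightarrow> (nat \<Rightarrow> 'a set) \<Rightarrow> bool" where
  "is_cycle Pr X \<psi> d D \<longleftrightarrow>
    d \<ge> 1 \<and> (\<forall>i<d. D i \<in> sets borel) \<and> disjoint_family_on D {..<d} \<and>
    (\<forall>i<d. \<forall>x\<in>D i. emeasure (n_step_kernel Pr X 1 x) (D (Suc i mod d)) = 1) \<and>
    emeasure \<psi> (- (\<Union>i<d. D i)) = 0"

text \<open>
  The period is the largest \<open>d\<close> for which a \<open>d\<close>-cycle exists; the whole space is always
  a \<open>1\<close>-cycle.
\<close>

definition aperiodic ::
    "('a::topological_space \<Rightarrow> 'w measure) \<Rightarrow> (nat \<Rightarrow> 'w \<Rightarrow> 'a) \<Rightarrow> 'a measure \<Rightarrow> bool" where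
  "aperiodic Pr X \<psi> \<longleftrightarrow> (\<forall>d D. is_cycle Pr X \<psi> d D \<longrightarrow> d = 1)"

text \<open>Weak Feller: \<open>P (\<cdot>, U)\<close> is lower semicontinuous for every open \<open>U\<close>.\<close>

definition feller ::
    "('a::topological_space \<Rightarrow> 'w measure) \<Rightarrow> (nat \<Rightarrow> 'w \<Rightarrow> 'a) \<Rightarrow> bool" where
  "feller Pr X \<longleftrightarrow>
    (\<forall>U. open U \<longrightarrow> (\<forall>x. emeasure (n_step_kernel Pr X 1 x) U
      \<le> Liminf (at x) (\<lambda>y. emeasure (n_step_kernel Pr X 1 y) U)))"

definition petite ::
    "('a::topological_space \<Rightarrow> 'w measure) \<Rightarrow> (nat \<Rightarrow> 'w \<Rightarrow> 'a) \<Rightarrow> 'a set \<Rightarrow> bool" where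
  "petite Pr X C \<longleftrightarrow>
    C \<in> sets borel \<and>
    (\<exists>(a :: nat pmf) (\<nu> :: 'a measure). sets \<nu> = sets borel \<and> emeasure \<nu> UNIV > 0 \<and>
      (\<forall>x\<in>C. \<forall>B\<in>sets borel.
        (\<Sum>n. ennreal (pmf a n) * emeasure (n_step_kernel Pr X n x) B) \<ge> emeasure \<nu> B))"

text \<open>The infimum of the empty set is \<open>\<infinity>\<close>.\<close>

definition return_time :: "(nat \<Rightarrow> 'w \<Rightarrow> 'a) \<Rightarrow> 'a set \<Rightarrow> 'w \<Rightarrow> ennreal" where
  "return_time X A \<omega> = (INF n\<in>{n. n \<ge> 1 \<and> X n \<omega> \<in> A}. of_nat n)"

definition harris_recurrent ::
    "('a::topological_space \<Rightarrow> 'w measure) \<Rightarrow> (nat \<Rightarrow> 'w \<Rightarrow> 'a) \<Rightarrow> 'a measure \<Rightarrow> bool" where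
  "harris_recurrent Pr X \<psi> \<longleftrightarrow>
    (\<forall>x. \<forall>A\<in>positive_sets \<psi>.
      AE \<omega> in Pr x. (\<Sum>n. indicator A (X (Suc n) \<omega>) :: ennreal) = \<infinity>)"

definition strongly_ergodic ::
    "('a::topological_space \<Rightarrow> 'w measure) \<Rightarrow> (nat \<Rightarrow> 'w \<Rightarrow> 'a) \<Rightarrow> bool" where
  "strongly_ergodic Pr X \<longleftrightarrow>
    (\<exists>C. petite Pr X C \<and> (SUP x. \<integral>\<^sup>+\<omega>. return_time X C \<omega> \<partial>Pr x) < \<infinity>)"

end

theory Submission
  imports Defs
begin

text \<open>
  Write \<open>u\<^sub>n(x) = P\<^sub>x(\<tau>\<^sub>A > n)\<close>, so that \<open>E\<^sub>x \<tau>\<^sub>A = \<Sum>n. u\<^sub>n(x)\<close>. If the chain is not strongly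
  ergodic, take \<open>A\<close> petite of positive measure and let \<open>V n\<close> be the truncated mean
  \<open>\<Sum>k<n. u\<^sub>k\<close> off \<open>A\<close>; one step from \<open>A\<close> adds at most 1 to the supremum over \<open>- A\<close>, so the latter is
  infinite as well. Conversely, iterating (2) bounds \<open>V n\<close> by the mean hitting time of \<open>A\<close>; strong
  ergodicity makes that mean bounded, because a petite set reaches \<open>A\<close> within a bounded time with
  probability bounded below.

  A petite set of positive measure is obtained from irreducibility alone: the resolvent \<open>K\<close> has
  \<open>\<psi>\<close> absolutely continuous with respect to every \<open>K(x, \<cdot>)\<close>, and two steps of \<open>K\<close> suffice.
\<close>

subsection \<open>A two-step minorization for dominating kernels\<close>

text \<open>Finite intersections of a countable base form a countable pi-system: almost sure
  identities can be collected over it, and measures agreeing on it coincide.\<close>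

lemma borel_countable_Int_stable_generator:
  obtains G :: "'a::second_countable_topology set set"
  where "countable G" "Int_stable G" "UNIV \<in> G" "sets borel = sigma_sets UNIV G"
proof -
  obtain B :: "'a set set" where B: "countable B" "topological_basis B"
    using ex_countable_basis by blast
  define G where "G = Inter ` {F. finite F \<and> F \<subseteq> B}"
  have "countable G"
    unfolding G_def by (intro countable_image countable_Collect_finite_subset B)
  moreover have "Int_stable G"
  proof (rule Int_stableI)
    fix a b assume "a \<in> G" "b \<in> G"
    then obtain F F' where "finite F" "F \<subseteq> B" "a = \<Inter>F" "finite F'" "F' \<subseteq> B" "b = \<Inter>F'"
      by (auto simp: G_def)
    then show "a \<inter> b \<in> G"
      unfolding G_def by (intro image_eqI[of _ _ "F \<union> F'"]) auto
  qed
  moreover have "UNIV \<in> G"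
    unfolding G_def by (rule image_eqI[of _ _ "{}"]) auto
  moreover have "sets borel = sigma_sets UNIV G"
  proof
    have "B \<subseteq> G"
      unfolding G_def by (auto intro!: image_eqI[of _ _ "{_}"])
    have "sets borel = sigma_sets UNIV B"
      unfolding borel_eq_countable_basis[OF B] by (rule sets_measure_of) simp
    then show "sets borel \<subseteq> sigma_sets UNIV G"
      using \<open>B \<subseteq> G\<close> sigma_sets_mono' by metis
    have "G \<subseteq> sets borel"
      unfolding G_def using topological_basis_open[OF B(2)] by (blast intro: borel_open open_Inter)
    then show "sigma_sets UNIV G \<subseteq> sets borel"
      using sets.sigma_sets_subset[of G borel] by simp
  qed
  ultimately show thesis
    using that by blast
qed

text \<open>A single use of Radon-Nikodym on the product space, for
  \<open>\<psi> \<Otimes>\<^sub>M \<psi>\<close> against \<psi>(dx) K(x, dy), yields a jointly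
  measurable density; separate derivatives for each \<open>x\<close> would not.\<close>

lemma kernel_domination:
  fixes \<psi> :: "'a::second_countable_topology measure" and K :: "'a \<Rightarrow> 'a measure"
  assumes "prob_space \<psi>" and sets_\<psi>[measurable_cong]: "sets \<psi> = sets borel"
    and K[measurable]: "K \<in> measurable borel (subprob_algebra borel)"
    and ac: "\<And>x. absolutely_continuous (K x) \<psi>"
  obtains f where "f \<in> borel_measurable (borel \<Otimes>\<^sub>M borel)"
    "AE x in \<psi>. density (K x) (\<lambda>y. f (x, y)) = \<psi>"
    "AE p in \<psi> \<Otimes>\<^sub>M \<psi>. f p < \<infinity>"
proof -
  interpret \<psi>: prob_space \<psi> by fact
  interpret pair_prob_space \<psi> \<psi> ..
  have space_\<psi>[simp]: "space \<psi> = UNIV"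
    using sets_eq_imp_space_eq[OF sets_\<psi>] by simp
  have [simp]: "sets (K x) = sets borel" "space (K x) = UNIV" for x
    using sets_kernel[OF K, of x] subprob_measurableD(1)[OF K, of x] by auto
  have [measurable_cong]: "sets (\<psi> \<Otimes>\<^sub>M \<psi>) = sets (borel \<Otimes>\<^sub>M borel)"
    by (intro sets_pair_measure_cong sets_\<psi>)
  \<comment> \<open>\<open>\<kappa>\<close> keeps the starting point, so that \<open>L\<close> is
    the joint measure \<psi>(dx) K(x, dy).\<close>
  define \<kappa> where "\<kappa> x = distr (K x) (borel \<Otimes>\<^sub>M borel) (Pair x)" for x
  have \<kappa>[measurable]: "\<kappa> \<in> measurable \<psi> (subprob_algebra (borel \<Otimes>\<^sub>M borel))"
    unfolding \<kappa>_def by (rule measurable_distr2[where M=borel]) measurable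
  define L where "L = \<psi> \<bind> \<kappa>"
  have sets_L: "sets L = sets (borel \<Otimes>\<^sub>M borel)"
    unfolding L_def by (rule sets_bind_measurable[OF \<kappa>]) simp
  interpret L: subprob_space L
    unfolding L_def by (rule subprob_space_bind[OF \<psi>.subprob_space_axioms \<kappa>])
  have nn_L: "(\<integral>\<^sup>+p. g p \<partial>L) = (\<integral>\<^sup>+x. \<integral>\<^sup>+y. g (x, y) \<partial>K x \<partial>\<psi>)"
    if [measurable]: "g \<in> borel_measurable (borel \<Otimes>\<^sub>M borel)" for g
    unfolding L_def nn_integral_bind[OF that \<kappa>] \<kappa>_def
    by (intro nn_integral_cong) (subst nn_integral_distr; simp)
  have meas: "(\<lambda>x. \<integral>\<^sup>+y. g (x, y) \<partial>K x) \<in> borel_measurable \<psi>"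
    if [measurable]: "g \<in> borel_measurable (borel \<Otimes>\<^sub>M borel)" for g
    unfolding measurable_cong_sets[OF sets_\<psi> refl]
    by (rule nn_integral_measurable_subprob_algebra2[OF _ K]) measurable
  \<comment> \<open>For almost every \<open>x\<close> the slice of an \<open>L\<close>-null set is
    null for \<open>K x\<close>, hence for \<psi> by \<open>ac\<close>; Fubini then makes the set
    null for the product.\<close>
  have "absolutely_continuous L (\<psi> \<Otimes>\<^sub>M \<psi>)"
    unfolding absolutely_continuous_def
  proof
    fix E assume "E \<in> null_sets L"
    then have [measurable]: "E \<in> sets (borel \<Otimes>\<^sub>M borel)" and "emeasure L E = 0"
      by (auto simp: sets_L)
    then have "(\<integral>\<^sup>+x. \<integral>\<^sup>+y. indicator E (x, y) \<partial>K x \<partial>\<psi>) = 0"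
      using nn_L[of "indicator E"] by (simp add: sets_L)
    then have "AE x in \<psi>. (\<integral>\<^sup>+y. indicator E (x, y) \<partial>K x) = 0"
      using meas[of "indicator E"] by (subst (asm) nn_integral_0_iff_AE) auto
    then have "AE x in \<psi>. emeasure \<psi> (Pair x -` E) = 0"
    proof eventually_elim
      fix x assume "(\<integral>\<^sup>+y. indicator E (x, y) \<partial>K x) = 0"
      moreover have "(\<integral>\<^sup>+y. indicator E (x, y) \<partial>K x) = (\<integral>\<^sup>+y. indicator (Pair x -` E) y \<partial>K x)"
        by (intro nn_integral_cong) (auto simp: indicator_def)
      moreover have "Pair x -` E \<in> sets borel"
        by measurable
      ultimately have "Pair x -` E \<in> null_sets (K x)"
        by (auto simp: null_sets_def)
      then show "emeasure \<psi> (Pair x -` E) = 0"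
        using ac[of x] unfolding absolutely_continuous_def by auto
    qed
    then have "emeasure (\<psi> \<Otimes>\<^sub>M \<psi>) E = 0"
      by (subst \<psi>.emeasure_pair_measure_alt) (auto simp: nn_integral_0_iff_AE \<psi>.measurable_emeasure_Pair)
    then show "E \<in> null_sets (\<psi> \<Otimes>\<^sub>M \<psi>)"
      by (auto simp: null_sets_def)
  qed
  moreover have "sets (\<psi> \<Otimes>\<^sub>M \<psi>) = sets L"
    unfolding sets_L by (intro sets_pair_measure_cong sets_\<psi>)
  ultimately obtain f where "f \<in> borel_measurable L" and f: "density L f = \<psi> \<Otimes>\<^sub>M \<psi>"
    using L.Radon_Nikodym by blast
  then have f_meas[measurable]: "f \<in> borel_measurable (borel \<Otimes>\<^sub>M borel)"
    by (simp cong: measurable_cong_sets add: sets_L)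
  have nn_f: "(\<integral>\<^sup>+p. g p \<partial>(\<psi> \<Otimes>\<^sub>M \<psi>)) = (\<integral>\<^sup>+x. \<integral>\<^sup>+y. f (x, y) * g (x, y) \<partial>K x \<partial>\<psi>)"
    if [measurable]: "g \<in> borel_measurable (borel \<Otimes>\<^sub>M borel)" for g
    unfolding f[symmetric]
    by (subst nn_integral_density) (auto simp: nn_L cong: measurable_cong_sets[OF sets_L])
  \<comment> \<open>Testing the density on rectangles \<open>A \<times> B\<close> shows that both
    sides, as functions of \<open>x\<close>, have equal integrals over every \<open>A\<close>. The
    exceptional set still depends on \<open>B\<close>.\<close>
  have slice: "AE x in \<psi>. (\<integral>\<^sup>+y. f (x, y) * indicator B y \<partial>K x) = emeasure \<psi> B"
    if [measurable]: "B \<in> sets borel" for B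
  proof (rule \<psi>.density_unique_finite_measure)
    show "(\<lambda>x. \<integral>\<^sup>+y. f (x, y) * indicator B y \<partial>K x) \<in> borel_measurable \<psi>"
      using meas[of "\<lambda>p. f p * indicator B (snd p)"] by simp
    fix A assume "A \<in> sets \<psi>"
    then have [measurable]: "A \<in> sets borel" by (simp add: sets_\<psi>)
    have "(\<integral>\<^sup>+x. (\<integral>\<^sup>+y. f (x, y) * indicator B y \<partial>K x) * indicator A x \<partial>\<psi>) =
      (\<integral>\<^sup>+x. \<integral>\<^sup>+y. f (x, y) * indicator (A \<times> B) (x, y) \<partial>K x \<partial>\<psi>)"
      by (intro nn_integral_cong) (auto simp: indicator_def intro!: nn_integral_cong)
    also have "\<dots> = emeasure (\<psi> \<Otimes>\<^sub>M \<psi>) (A \<times> B)"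
      by (subst nn_f[symmetric]) auto
    also have "\<dots> = emeasure \<psi> B * emeasure \<psi> A"
      by (subst \<psi>.emeasure_pair_measure_Times) (auto simp: sets_\<psi> mult.commute)
    also have "\<dots> = (\<integral>\<^sup>+x. emeasure \<psi> B * indicator A x \<partial>\<psi>)"
      by (subst nn_integral_cmult_indicator) (auto simp: sets_\<psi>)
    finally show "(\<integral>\<^sup>+x. (\<integral>\<^sup>+y. f (x, y) * indicator B y \<partial>K x) * indicator A x \<partial>\<psi>) =
      (\<integral>\<^sup>+x. emeasure \<psi> B * indicator A x \<partial>\<psi>)" .
  qed auto
  obtain G :: "'a set set" where G: "countable G" "Int_stable G" "UNIV \<in> G" "sets borel = sigma_sets UNIV G"
    by (rule borel_countable_Int_stable_generator)
  have "G \<subseteq> sets borel" using G(4) by auto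
  \<comment> \<open>Countability of \<open>G\<close> merges the exceptional sets into one null
    set.\<close>
  then have "AE x in \<psi>. \<forall>B\<in>G. (\<integral>\<^sup>+y. f (x, y) * indicator B y \<partial>K x) = emeasure \<psi> B"
    by (intro AE_ball_countable[THEN iffD2] ballI slice G(1)) auto
  then have "AE x in \<psi>. density (K x) (\<lambda>y. f (x, y)) = \<psi>"
  proof eventually_elim
    fix x assume *: "\<forall>B\<in>G. (\<integral>\<^sup>+y. f (x, y) * indicator B y \<partial>K x) = emeasure \<psi> B"
    have "emeasure (density (K x) (\<lambda>y. f (x, y))) B = emeasure \<psi> B" if "B \<in> G" for B
      using that * \<open>G \<subseteq> sets borel\<close> by (subst emeasure_density) auto
    then show "density (K x) (\<lambda>y. f (x, y)) = \<psi>"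
      using G \<psi>.emeasure_space_1
      by (intro measure_eqI_generator_eq[OF G(2), where A="\<lambda>_. UNIV" and \<Omega>=UNIV])
         (auto simp: sets_\<psi>)
  qed
  \<comment> \<open>The \<open>L\<close>-integral of \<open>f\<close> is the total mass 1 of the
    product, so \<open>f\<close> is finite \<open>L\<close>-almost everywhere; the product has a
    density with respect to \<open>L\<close> and inherits this.\<close>
  moreover have "AE p in \<psi> \<Otimes>\<^sub>M \<psi>. f p < \<infinity>"
  proof -
    have "AE p in L. f p \<noteq> \<infinity>"
    proof (rule nn_integral_PInf_AE)
      show "f \<in> borel_measurable L" by fact
      have "(\<integral>\<^sup>+p. f p \<partial>L) = emeasure (density L f) (space L)"
        using \<open>f \<in> borel_measurable L\<close> by (subst emeasure_density) (auto intro!: nn_integral_cong)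
      also have "\<dots> = 1"
        unfolding f using P.emeasure_space_1 sets_eq_imp_space_eq[OF sets_L] by (simp add: space_pair_measure)
      finally show "(\<integral>\<^sup>+p. f p \<partial>L) \<noteq> \<infinity>" by simp
    qed
    then show ?thesis
      unfolding f[symmetric] using \<open>f \<in> borel_measurable L\<close>
      by (subst AE_density) (auto simp: top.not_eq_extremum elim!: eventually_mono)
  qed
  ultimately show thesis
    using f_meas that by blast
qed

text \<open>
  With \<open>E\<close> a sublevel set of the density \<open>f\<close> of \<open>\<psi> \<Otimes>\<^sub>M \<psi>\<close> with respect to
  \<open>\<psi>(dx) K(x, dy)\<close>, the kernel \<open>K\<close> dominates \<open>\<psi>\<close> restricted to the slices of \<open>E\<close>. Two sets of
  measure above 3/4 overlap in measure at least 1/2, so two steps of \<open>K\<close> can be chained.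
\<close>

lemma two_step_minorization:
  fixes \<psi> :: "'a::second_countable_topology measure" and K :: "'a \<Rightarrow> 'a measure"
  assumes "prob_space \<psi>" and sets_\<psi>[measurable_cong]: "sets \<psi> = sets borel"
    and K[measurable]: "K \<in> measurable borel (subprob_algebra borel)"
    and ac: "\<And>x. absolutely_continuous (K x) \<psi>"
  obtains C D :: "'a set" and c :: real where
    "C \<in> sets borel" "emeasure \<psi> C > 0" "D \<in> sets borel" "emeasure \<psi> D > 0" "c > 0"
    "\<And>x B. x \<in> C \<Longrightarrow> B \<in> sets borel \<Longrightarrow> ennreal c * emeasure \<psi> (B \<inter> D) \<le> emeasure (K x \<bind> K) B"
proof -
  interpret \<psi>: prob_space \<psi> by fact
  interpret P: pair_prob_space \<psi> \<psi> ..
  have space_\<psi>[simp]: "space \<psi> = UNIV"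
    using sets_eq_imp_space_eq[OF sets_\<psi>] by simp
  have [simp]: "sets (K x) = sets borel" "space (K x) = UNIV" for x
    using sets_kernel[OF K, of x] subprob_measurableD(1)[OF K, of x] by auto
  have sets_\<psi>\<psi>[measurable_cong]: "sets (\<psi> \<Otimes>\<^sub>M \<psi>) = sets (borel \<Otimes>\<^sub>M borel)"
    by (intro sets_pair_measure_cong sets_\<psi>)
  obtain f where f[measurable]: "f \<in> borel_measurable (borel \<Otimes>\<^sub>M borel)"
    and dens: "AE x in \<psi>. density (K x) (\<lambda>y. f (x, y)) = \<psi>"
    and fin: "AE p in \<psi> \<Otimes>\<^sub>M \<psi>. f p < \<infinity>"
    by (rule kernel_domination[OF assms])
  define E where "E n = {p. f p \<le> of_nat n}" for n :: nat
  have E[measurable]: "E n \<in> sets (borel \<Otimes>\<^sub>M borel)" for n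
  proof -
    have "{p \<in> space (borel \<Otimes>\<^sub>M borel). f p \<le> of_nat n} \<in> sets (borel \<Otimes>\<^sub>M borel)"
      by measurable
    then show ?thesis by (simp add: E_def space_pair_measure)
  qed
  \<comment> \<open>Since \<open>f\<close> is finite almost everywhere, its sublevel sets increase
    to a set of full measure, so one of them has measure above 3/4.\<close>
  have "(\<lambda>n. P.prob (E n)) \<longlonglongrightarrow> P.prob (\<Union>n. E n)"
  proof (rule P.finite_Lim_measure_incseq)
    show "range E \<subseteq> P.events" using E by (auto simp: sets_\<psi>\<psi>)
    show "incseq E" unfolding E_def by (rule incseq_SucI) (auto intro: order.trans)
  qed
  also have "P.prob (\<Union>n. E n) = 1"
  proof (rule P.prob_eq_1[THEN iffD2])
    show "AE p in \<psi> \<Otimes>\<^sub>M \<psi>. p \<in> (\<Union>n. E n)"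
      using fin by eventually_elim
        (auto simp: E_def dest!: ennreal_Ex_less_of_nat intro: less_imp_le)
  qed measurable
  finally have "\<forall>\<^sub>F n in sequentially. P.prob (E n) > 3/4"
    by (rule order_tendstoD) simp
  from eventually_conj[OF this eventually_gt_at_top[of 0]]
  obtain n where n: "P.prob (E n) > 3/4" and n_pos: "n > 0"
    by (auto simp: eventually_sequentially)
  define F where "F = E n"
  have F[measurable]: "F \<in> sets (borel \<Otimes>\<^sub>M borel)"
    by (simp add: F_def)
  have F_gt: "emeasure (\<psi> \<Otimes>\<^sub>M \<psi>) F > ennreal (3/4)"
    using n by (simp add: F_def P.emeasure_eq_measure ennreal_less_iff)
  have F1[measurable]: "Pair x -` F \<in> sets borel" and F2[measurable]: "(\<lambda>x. (x, z)) -` F \<in> sets borel" for x z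
    using sets_Pair1[OF F, of x] sets_Pair2[OF F, of z] by auto
  have mF1[measurable]: "(\<lambda>x. emeasure \<psi> (Pair x -` F)) \<in> borel_measurable borel"
    using \<psi>.measurable_emeasure_Pair[of F borel] by simp
  have mF2[measurable]: "(\<lambda>z. emeasure \<psi> ((\<lambda>x. (x, z)) -` F)) \<in> borel_measurable borel"
    using P.measurable_emeasure_Pair2[of F] by simp
  \<comment> \<open>By Fubini this applies to the measures of the slices of \<open>F\<close> in
    either direction.\<close>
  have *: "emeasure \<psi> {x. g x > ennreal (3/4)} > 0"
    if [measurable]: "g \<in> borel_measurable borel" and g: "ennreal (3/4) < (\<integral>\<^sup>+x. g x \<partial>\<psi>)" for g
  proof (rule ccontr)
    assume "\<not> emeasure \<psi> {x. g x > ennreal (3/4)} > 0"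
    then have "AE x in \<psi>. \<not> g x > ennreal (3/4)"
      by (subst AE_iff_measurable[of "{x. g x > ennreal (3/4)}"]) auto
    then have "(\<integral>\<^sup>+x. g x \<partial>\<psi>) \<le> (\<integral>\<^sup>+x. ennreal (3/4) \<partial>\<psi>)"
      by (intro nn_integral_mono_AE) (auto simp: not_less)
    then show False
      using g \<psi>.emeasure_space_1 by (simp add: not_less)
  qed
  define C0 where "C0 = {x. emeasure \<psi> (Pair x -` F) > ennreal (3/4)}"
  define D where "D = {z. emeasure \<psi> ((\<lambda>x. (x, z)) -` F) > ennreal (3/4)}"
  have [measurable]: "C0 \<in> sets borel" "D \<in> sets borel"
    by (simp_all add: C0_def D_def)
  have C0_pos: "emeasure \<psi> C0 > 0"
    unfolding C0_def using F_gt by (intro *) (simp_all add: \<psi>.emeasure_pair_measure_alt)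
  have D_pos: "emeasure \<psi> D > 0"
    unfolding D_def using F_gt by (intro *) (simp_all add: P.emeasure_pair_measure_alt2)
  obtain N where N: "N \<in> null_sets \<psi>" "{x. density (K x) (\<lambda>y. f (x, y)) \<noteq> \<psi>} \<subseteq> N"
    using dens by (elim AE_E) (auto simp: null_sets_def)
  define C where "C = C0 - N"
  have [measurable]: "N \<in> sets borel" using N(1) by (auto simp: sets_\<psi>)
  have C_meas[measurable]: "C \<in> sets borel" by (simp add: C_def)
  have C_pos: "emeasure \<psi> C > 0"
    unfolding C_def using C0_pos N(1) by (subst emeasure_Diff_null_set) (auto simp: sets_\<psi>)
  \<comment> \<open>On \<open>F\<close> the density is at most \<open>n\<close>, so \<psi>
    restricted to the slice of \<open>F\<close> at \<open>x\<close> is dominated by \<open>n\<close>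
    times \<open>K x\<close>.\<close>
  have dom: "(\<integral>\<^sup>+y. g y * indicator F (x, y) \<partial>\<psi>) \<le> of_nat n * (\<integral>\<^sup>+y. g y \<partial>K x)"
    if "x \<notin> N" and [measurable]: "g \<in> borel_measurable borel" for x g
  proof -
    have "density (K x) (\<lambda>y. f (x, y)) = \<psi>" using N(2) that(1) by auto
    then have "(\<integral>\<^sup>+y. g y * indicator F (x, y) \<partial>\<psi>) =
        (\<integral>\<^sup>+y. g y * indicator F (x, y) \<partial>density (K x) (\<lambda>y. f (x, y)))" by simp
    also have "\<dots> = (\<integral>\<^sup>+y. f (x, y) * (g y * indicator F (x, y)) \<partial>K x)"
      by (subst nn_integral_density) auto
    also have "\<dots> \<le> (\<integral>\<^sup>+y. of_nat n * g y \<partial>K x)"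
      by (intro nn_integral_mono)
         (auto simp: F_def E_def indicator_def intro!: mult_right_mono)
    also have "\<dots> = of_nat n * (\<integral>\<^sup>+y. g y \<partial>K x)"
      by (rule nn_integral_cmult) simp
    finally show ?thesis .
  qed
  have key: "ennreal (1/2) * emeasure \<psi> (B \<inter> D) \<le> of_nat n * (of_nat n * emeasure (K x \<bind> K) B)"
    if "x \<in> C" and [measurable]: "B \<in> sets borel" for x B
  proof -
    \<comment> \<open>The two slices intersect in the midpoints \<open>y\<close> with both
      \<open>(x, y)\<close> and \<open>(y, z)\<close> in \<open>F\<close>; inclusion-exclusion gives
      them measure at least 3/4 + 3/4 - 1.\<close>
    have half: "ennreal (1/2) * indicator (B \<inter> D) z \<le>
      indicator B z * (\<integral>\<^sup>+y. indicator F (x, y) * indicator F (y, z) \<partial>\<psi>)" for z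
    proof (cases "z \<in> B \<inter> D")
      case True
      let ?A = "Pair x -` F" and ?A' = "(\<lambda>y. (y, z)) -` F"
      have A: "\<psi>.prob ?A > 3/4" "\<psi>.prob ?A' > 3/4"
        using True that(1) by (auto simp: C_def C0_def D_def \<psi>.emeasure_eq_measure ennreal_less_iff)
      have "\<psi>.prob (?A \<union> ?A') = \<psi>.prob ?A + \<psi>.prob (?A' - ?A)"
        by (rule \<psi>.finite_measure_Union') simp_all
      moreover have "\<psi>.prob (?A' - ?A) = \<psi>.prob ?A' - \<psi>.prob (?A' \<inter> ?A)"
        by (rule \<psi>.finite_measure_Diff') simp_all
      ultimately have "1/2 \<le> \<psi>.prob (?A \<inter> ?A')"
        using A \<psi>.prob_le_1[of "?A \<union> ?A'"] by (simp add: Int_commute)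
      have "(\<integral>\<^sup>+y. indicator F (x, y) * indicator F (y, z) \<partial>\<psi>) = (\<integral>\<^sup>+y. indicator (?A \<inter> ?A') y \<partial>\<psi>)"
        by (intro nn_integral_cong) (auto simp: indicator_def)
      also have "\<dots> = emeasure \<psi> (?A \<inter> ?A')"
        by (subst nn_integral_indicator) auto
      finally show ?thesis
        using True \<open>1/2 \<le> \<psi>.prob (?A \<inter> ?A')\<close>
        by (simp add: \<psi>.emeasure_eq_measure ennreal_leI del: ennreal_half)
    qed (auto simp: indicator_def)
    have "ennreal (1/2) * emeasure \<psi> (B \<inter> D) = (\<integral>\<^sup>+z. ennreal (1/2) * indicator (B \<inter> D) z \<partial>\<psi>)"
      by (subst nn_integral_cmult_indicator) auto
    also have "\<dots> \<le> (\<integral>\<^sup>+z. indicator B z * (\<integral>\<^sup>+y. indicator F (x, y) * indicator F (y, z) \<partial>\<psi>) \<partial>\<psi>)"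
      by (intro nn_integral_mono half)
    also have "\<dots> = (\<integral>\<^sup>+z. \<integral>\<^sup>+y. indicator B z * indicator F (y, z) * indicator F (x, y) \<partial>\<psi> \<partial>\<psi>)"
      by (intro nn_integral_cong) (simp add: nn_integral_cmult[symmetric] mult_ac)
    \<comment> \<open>With the midpoint \<open>y\<close> outermost, \<open>dom\<close> first turns
      the inner integral into a step of \<open>K\<close> from \<open>y\<close>, for almost every
      \<open>y\<close>, and then the outer one into a step from \<open>x\<close>.\<close>
    also have "\<dots> = (\<integral>\<^sup>+y. \<integral>\<^sup>+z. indicator B z * indicator F (y, z) * indicator F (x, y) \<partial>\<psi> \<partial>\<psi>)"
      by (rule P.Fubini'[symmetric]) measurable
    also have "\<dots> = (\<integral>\<^sup>+y. (\<integral>\<^sup>+z. indicator B z * indicator F (y, z) \<partial>\<psi>) * indicator F (x, y) \<partial>\<psi>)"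
      by (intro nn_integral_cong nn_integral_multc) measurable
    also have "\<dots> \<le> (\<integral>\<^sup>+y. (of_nat n * emeasure (K y) B) * indicator F (x, y) \<partial>\<psi>)"
    proof (rule nn_integral_mono_AE)
      have "AE y in \<psi>. y \<notin> N" using N(1) by (rule AE_not_in)
      then show "AE y in \<psi>. (\<integral>\<^sup>+z. indicator B z * indicator F (y, z) \<partial>\<psi>) * indicator F (x, y)
          \<le> of_nat n * emeasure (K y) B * indicator F (x, y)"
      proof eventually_elim
        fix y assume "y \<notin> N"
        from dom[OF this, of "indicator B"]
        show "(\<integral>\<^sup>+z. indicator B z * indicator F (y, z) \<partial>\<psi>) * indicator F (x, y)
          \<le> of_nat n * emeasure (K y) B * indicator F (x, y)"
          by (intro mult_right_mono) simp_all
      qed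
    qed
    also have "\<dots> \<le> of_nat n * (\<integral>\<^sup>+y. of_nat n * emeasure (K y) B \<partial>K x)"
      using that by (intro dom) (auto simp: C_def)
    also have "(\<integral>\<^sup>+y. of_nat n * emeasure (K y) B \<partial>K x) = of_nat n * emeasure (K x \<bind> K) B"
      by (subst nn_integral_cmult, measurable) (subst emeasure_bind[OF _ _ that(2)]; simp)
    finally show ?thesis .
  qed
  show thesis
  proof
    \<comment> \<open>The factor 1/2 comes from the overlap, and a factor 1/n from each of the two
      steps.\<close>
    show "1 / (2 * real n * real n) > 0" using n_pos by simp
    fix x :: 'a and B :: "'a set" assume "x \<in> C" "B \<in> sets borel"
    define a where "a = 1 / (real n * real n)"
    have a: "a \<ge> 0" "a * real n * real n = 1" and c: "1 / (2 * real n * real n) = a * (1/2)"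
      using n_pos by (simp_all add: a_def)
    have "ennreal (a * (1/2)) * emeasure \<psi> (B \<inter> D) = ennreal a * (ennreal (1/2) * emeasure \<psi> (B \<inter> D))"
      using a(1) by (simp only: ennreal_mult mult.assoc)
    also have "\<dots> \<le> ennreal a * (of_nat n * (of_nat n * emeasure (K x \<bind> K) B))"
      by (intro mult_left_mono key \<open>x \<in> C\<close> \<open>B \<in> sets borel\<close>) simp
    also have "\<dots> = ennreal (a * real n * real n) * emeasure (K x \<bind> K) B"
      using a(1) by (simp only: ennreal_of_nat_eq_real_of_nat ennreal_mult mult.assoc mult_nonneg_nonneg of_nat_0_le_iff)
    finally show "ennreal (1 / (2 * real n * real n)) * emeasure \<psi> (B \<inter> D) \<le> emeasure (K x \<bind> K) B"
      by (simp only: a(2) c) simp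
  qed fact+
qed

subsection \<open>Markov chains and their taboo probabilities\<close>

locale markov_process =
  fixes Pr :: "'a::topological_space \<Rightarrow> 'w measure" and X :: "nat \<Rightarrow> 'w \<Rightarrow> 'a"
  assumes markov_chain: "markov_chain Pr X"
begin

abbreviation kern :: "nat \<Rightarrow> 'a \<Rightarrow> 'a measure" where
  "kern \<equiv> n_step_kernel Pr X"

definition step :: "'a \<Rightarrow> 'a measure" where
  "step = n_step_kernel Pr X 1"

lemma prob_space_Pr: "prob_space (Pr x)"
  and X_measurable[measurable]: "X n \<in> measurable (Pr x) borel"
  and X_0: "AE \<omega> in Pr x. X 0 \<omega> = x"
  and step_measurable[measurable]: "step \<in> measurable borel (subprob_algebra borel)"
  using markov_chain unfolding markov_chain_def step_def by auto

lemma past_subset_sets: "past (space (Pr x)) X n \<subseteq> sets (Pr x)"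
  unfolding past_def by (rule sets.sigma_sets_subset) auto

lemma markov_emeasure:
  assumes "F \<in> past (space (Pr x)) X n" "A \<in> sets borel"
  shows "emeasure (Pr x) {\<omega>\<in>F. X (Suc n) \<omega> \<in> A} = (\<integral>\<^sup>+\<omega>\<in>F. emeasure (step (X n \<omega>)) A \<partial>Pr x)"
  using markov_chain assms unfolding markov_chain_def step_def by blast

lemma sets_kern[simp, measurable_cong]: "sets (kern n x) = sets borel"
  and space_kern[simp]: "space (kern n x) = UNIV"
  by (simp_all add: n_step_kernel_def)

lemma sets_step[simp, measurable_cong]: "sets (step x) = sets borel"
  and space_step[simp]: "space (step x) = UNIV"
  by (simp_all add: step_def)

lemma prob_space_kern: "prob_space (kern n x)"
  unfolding n_step_kernel_def by (intro prob_space.prob_space_distr prob_space_Pr X_measurable)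

lemma prob_space_step: "prob_space (step x)"
  unfolding step_def by (rule prob_space_kern)

lemma space_Pr_not_empty[simp]: "space (Pr x) \<noteq> {}"
  using prob_space_Pr prob_space.not_empty by blast

text \<open>Restricted to \<open>F\<close>, the law of the next state is that of the current state
  pushed through \<open>step\<close>. As an equality of measures this carries the Markov property
  from sets to functions.\<close>

lemma markov_nn_integral:
  assumes F: "F \<in> past (space (Pr x)) X n" and g[measurable]: "g \<in> borel_measurable borel"
  shows "(\<integral>\<^sup>+\<omega>. indicator F \<omega> * g (X (Suc n) \<omega>) \<partial>Pr x) =
    (\<integral>\<^sup>+\<omega>. indicator F \<omega> * (\<integral>\<^sup>+y. g y \<partial>step (X n \<omega>)) \<partial>Pr x)"
proof -
  have F'[measurable]: "F \<in> sets (Pr x)" using F past_subset_sets by auto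
  define M where "M = density (Pr x) (indicator F)"
  have [measurable_cong]: "sets M = sets (Pr x)" and [simp]: "space M \<noteq> {}"
    by (simp_all add: M_def)
  have m1[measurable]: "(\<lambda>\<omega>. step (X n \<omega>)) \<in> measurable M (subprob_algebra borel)"
    by measurable
  have "distr M borel (X (Suc n)) = M \<bind> (\<lambda>\<omega>. step (X n \<omega>))"
  proof (rule measure_eqI)
    show "sets (distr M borel (X (Suc n))) = sets (M \<bind> (\<lambda>\<omega>. step (X n \<omega>)))"
      by (subst sets_bind_measurable[OF m1]) auto
    fix A assume "A \<in> sets (distr M borel (X (Suc n)))"
    then have A[measurable]: "A \<in> sets borel" by simp
    have "emeasure (distr M borel (X (Suc n))) A =
        (\<integral>\<^sup>+\<omega>. indicator F \<omega> * indicator (X (Suc n) -` A \<inter> space (Pr x)) \<omega> \<partial>Pr x)"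
      unfolding M_def by (subst emeasure_distr, measurable) (subst emeasure_density; simp)
    also have "\<dots> = (\<integral>\<^sup>+\<omega>. indicator {\<omega>\<in>F. X (Suc n) \<omega> \<in> A} \<omega> \<partial>Pr x)"
      by (intro nn_integral_cong) (auto simp: indicator_def)
    also have "\<dots> = emeasure (Pr x) {\<omega>\<in>F. X (Suc n) \<omega> \<in> A}"
    proof (rule nn_integral_indicator)
      have "{\<omega>\<in>F. X (Suc n) \<omega> \<in> A} = F \<inter> (X (Suc n) -` A \<inter> space (Pr x))"
        using sets.sets_into_space[OF F'] by auto
      then show "{\<omega>\<in>F. X (Suc n) \<omega> \<in> A} \<in> sets (Pr x)" by simp
    qed
    also have "\<dots> = (\<integral>\<^sup>+\<omega>. indicator F \<omega> * emeasure (step (X n \<omega>)) A \<partial>Pr x)"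
      by (simp add: markov_emeasure[OF F A] mult.commute)
    also have "\<dots> = (\<integral>\<^sup>+\<omega>. emeasure (step (X n \<omega>)) A \<partial>M)"
      unfolding M_def by (subst nn_integral_density) auto
    also have "\<dots> = emeasure (M \<bind> (\<lambda>\<omega>. step (X n \<omega>))) A"
      by (subst emeasure_bind[OF _ m1]) auto
    finally show "emeasure (distr M borel (X (Suc n))) A = emeasure (M \<bind> (\<lambda>\<omega>. step (X n \<omega>))) A" .
  qed
  then have "(\<integral>\<^sup>+y. g y \<partial>distr M borel (X (Suc n))) = (\<integral>\<^sup>+y. g y \<partial>(M \<bind> (\<lambda>\<omega>. step (X n \<omega>))))"
    by simp
  then have "(\<integral>\<^sup>+\<omega>. g (X (Suc n) \<omega>) \<partial>M) = (\<integral>\<^sup>+\<omega>. (\<integral>\<^sup>+y. g y \<partial>step (X n \<omega>)) \<partial>M)"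
    by (simp add: nn_integral_distr nn_integral_bind[OF g m1])
  then show ?thesis
    unfolding M_def by (simp add: nn_integral_density)
qed

section \<open>The n-step kernels and the Chapman-Kolmogorov equation\<close>

lemma kern_0: "kern 0 x = return borel x"
proof (rule measure_eqI)
  interpret prob_space "Pr x" by (rule prob_space_Pr)
  fix A assume "A \<in> sets (kern 0 x)"
  then have [measurable]: "A \<in> sets borel" by simp
  have "emeasure (kern 0 x) A = (\<integral>\<^sup>+\<omega>. indicator A (X 0 \<omega>) \<partial>Pr x)"
    unfolding n_step_kernel_def by (simp add: nn_integral_distr flip: nn_integral_indicator)
  also have "\<dots> = (\<integral>\<^sup>+\<omega>. indicator A x \<partial>Pr x)"
    using X_0[of x] by (intro nn_integral_cong_AE) auto
  finally show "emeasure (kern 0 x) A = emeasure (return borel x) A"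
    by (simp add: emeasure_space_1)
qed simp

lemma kern_Suc: "kern (Suc n) x = kern n x \<bind> step"
proof (rule measure_eqI)
  show "sets (kern (Suc n) x) = sets (kern n x \<bind> step)"
    by (subst sets_bind_measurable[where B=borel]) auto
  fix A assume "A \<in> sets (kern (Suc n) x)"
  then have A[measurable]: "A \<in> sets borel" by simp
  have "space (Pr x) \<in> past (space (Pr x)) X n"
    unfolding past_def by (rule sigma_sets_top)
  from markov_nn_integral[OF this, of "indicator A"]
  have "(\<integral>\<^sup>+\<omega>. indicator A (X (Suc n) \<omega>) \<partial>Pr x) = (\<integral>\<^sup>+\<omega>. emeasure (step (X n \<omega>)) A \<partial>Pr x)"
    by (simp cong: nn_integral_cong)
  then have "(\<integral>\<^sup>+y. indicator A y \<partial>kern (Suc n) x) = (\<integral>\<^sup>+y. emeasure (step y) A \<partial>kern n x)"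
    unfolding n_step_kernel_def by (simp add: nn_integral_distr del: nn_integral_indicator)
  then show "emeasure (kern (Suc n) x) A = emeasure (kern n x \<bind> step) A"
    by (subst emeasure_bind[where N=borel]) auto
qed

text \<open>Only the one-step kernel is measurable by definition; the recursion
  \<open>kern_Suc\<close> passes this on to all powers.\<close>

lemma kern_measurable[measurable]: "kern n \<in> measurable borel (subprob_algebra borel)"
proof (induction n)
  case 0
  have "kern 0 = return borel" by (rule ext) (rule kern_0)
  then show ?case by simp
next
  case (Suc n)
  have "kern (Suc n) = (\<lambda>x. kern n x \<bind> step)" by (rule ext) (rule kern_Suc)
  then show ?case using measurable_bind2[OF Suc step_measurable] by simp
qed

lemma kern_add: "kern (m + n) x = kern m x \<bind> kern n"
proof (induction n)
  case 0
  have "kern 0 = return borel" by (rule ext) (rule kern_0)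
  then show ?case by (simp add: bind_return'')
next
  case (Suc n)
  have "kern (Suc n) = (\<lambda>y. kern n y \<bind> step)" by (rule ext) (rule kern_Suc)
  then show ?case
    using Suc by (simp add: kern_Suc bind_assoc[where N=borel and R=borel])
qed

lemma emeasure_kern_add:
  "B \<in> sets borel \<Longrightarrow> emeasure (kern (m + n) x) B = (\<integral>\<^sup>+y. emeasure (kern n y) B \<partial>kern m x)"
  by (simp add: kern_add emeasure_bind[where N=borel])

section \<open>The chain sampled at an independent random time\<close>

definition sampled :: "nat pmf \<Rightarrow> 'a \<Rightarrow> 'a measure" where
  "sampled a x = measure_pmf a \<bind> (\<lambda>n. kern n x)"

lemma kern_measurable_pmf: "(\<lambda>n. kern n x) \<in> measurable (measure_pmf a) (subprob_algebra borel)"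
  using prob_space_kern[of _ x]
  by (auto simp: measurable_def space_subprob_algebra prob_space_imp_subprob_space)

lemma sampled_measurable[measurable]: "sampled a \<in> measurable borel (subprob_algebra borel)"
proof -
  have "(\<lambda>x. measure_pmf a \<bind> (\<lambda>n. kern n x)) \<in> measurable borel (subprob_algebra borel)"
  proof (rule measurable_bind')
    show "(\<lambda>x. measure_pmf a) \<in> measurable borel (subprob_algebra (count_space UNIV))"
      by (simp add: measure_pmf_in_subprob_algebra)
    show "case_prod (\<lambda>x n. kern n x) \<in> measurable (borel \<Otimes>\<^sub>M count_space UNIV) (subprob_algebra borel)"
      using measurable_compose_countable[where f="\<lambda>n p. kern n (fst p)" and g=snd
        and M="borel \<Otimes>\<^sub>M count_space UNIV" and N="subprob_algebra borel"]
      by (simp add: case_prod_beta')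
  qed
  then show ?thesis by (simp add: sampled_def[abs_def])
qed

lemma sets_sampled[simp, measurable_cong]: "sets (sampled a x) = sets borel"
  and space_sampled[simp]: "space (sampled a x) = UNIV"
  using sets_kernel[OF sampled_measurable, of x] subprob_measurableD(1)[OF sampled_measurable, of x]
  by auto

lemma emeasure_sampled:
  "B \<in> sets borel \<Longrightarrow> emeasure (sampled a x) B = (\<integral>\<^sup>+n. emeasure (kern n x) B \<partial>measure_pmf a)"
  unfolding sampled_def by (rule emeasure_bind[OF _ kern_measurable_pmf]) auto

lemma nn_integral_sampled:
  "g \<in> borel_measurable borel \<Longrightarrow>
    (\<integral>\<^sup>+y. g y \<partial>sampled a x) = (\<integral>\<^sup>+n. \<integral>\<^sup>+y. g y \<partial>kern n x \<partial>measure_pmf a)"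
  unfolding sampled_def by (rule nn_integral_bind[OF _ kern_measurable_pmf])

lemma nn_integral_nat_pmf:
  "(\<integral>\<^sup>+n. f n \<partial>measure_pmf a) = (\<Sum>n. ennreal (pmf a n) * f n)" for a :: "nat pmf"
  by (simp add: nn_integral_measure_pmf nn_integral_count_space_nat)

lemma emeasure_sampled_suminf:
  "B \<in> sets borel \<Longrightarrow>
    emeasure (sampled a x) B = (\<Sum>n. ennreal (pmf a n) * emeasure (kern n x) B)"
  by (simp add: emeasure_sampled nn_integral_nat_pmf)

definition conv_pmf :: "nat pmf \<Rightarrow> nat pmf \<Rightarrow> nat pmf" where
  "conv_pmf a b = bind_pmf a (\<lambda>i. map_pmf ((+) i) b)"

text \<open>Chapman-Kolmogorov averaged over two independent times. Hence two successive sampled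
  steps are one sampled step, the form that petiteness asks for.\<close>

lemma nn_integral_emeasure_sampled:
  assumes B[measurable]: "B \<in> sets borel"
  shows "(\<integral>\<^sup>+y. emeasure (sampled b y) B \<partial>sampled a x) = emeasure (sampled (conv_pmf a b) x) B"
proof -
  have "(\<integral>\<^sup>+y. emeasure (sampled b y) B \<partial>kern i x) = (\<integral>\<^sup>+j. emeasure (kern (i + j) x) B \<partial>measure_pmf b)" for i
  proof -
    have "(\<integral>\<^sup>+y. emeasure (sampled b y) B \<partial>kern i x) =
        (\<integral>\<^sup>+y. (\<Sum>n. ennreal (pmf b n) * emeasure (kern n y) B) \<partial>kern i x)"
      by (simp add: emeasure_sampled_suminf)
    also have "\<dots> = (\<Sum>n. \<integral>\<^sup>+y. ennreal (pmf b n) * emeasure (kern n y) B \<partial>kern i x)"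
      by (rule nn_integral_suminf) simp
    also have "\<dots> = (\<Sum>n. ennreal (pmf b n) * emeasure (kern (i + n) x) B)"
      by (simp add: nn_integral_cmult emeasure_kern_add)
    finally show ?thesis by (simp add: nn_integral_nat_pmf)
  qed
  then show ?thesis
    by (simp add: nn_integral_sampled emeasure_sampled conv_pmf_def)
qed

section \<open>Avoidance of a set and the taboo operator\<close>

definition avoids :: "'a set \<Rightarrow> nat \<Rightarrow> 'w \<Rightarrow> bool" where
  "avoids A n \<omega> \<longleftrightarrow> (\<forall>i\<in>{1..n}. X i \<omega> \<notin> A)"

lemma avoids_0[simp]: "avoids A 0 \<omega>"
  and avoids_Suc: "avoids A (Suc n) \<omega> \<longleftrightarrow> avoids A n \<omega> \<and> X (Suc n) \<omega> \<notin> A"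
  by (auto simp: avoids_def atLeastAtMostSuc_conv)

lemma avoids_past:
  assumes "A \<in> sets borel"
  shows "{\<omega>\<in>space (Pr x). avoids A n \<omega>} \<in> past (space (Pr x)) X n"
proof -
  have "i \<le> n \<Longrightarrow> {\<omega>\<in>space (Pr x). avoids A i \<omega>} \<in> past (space (Pr x)) X n" for i
  proof (induction i)
    case 0
    then show ?case by (simp add: past_def sigma_sets_top)
  next
    case (Suc i)
    interpret S: sigma_algebra "space (Pr x)" "past (space (Pr x)) X n"
      unfolding past_def by (rule sigma_algebra_sigma_sets) auto
    have "X (Suc i) -` (- A) \<inter> space (Pr x) \<in> past (space (Pr x)) X n"
      unfolding past_def using Suc.prems assms
      by (intro sigma_sets.Basic CollectI exI[of _ "Suc i"] exI[of _ "- A"]) auto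
    then have "{\<omega>\<in>space (Pr x). avoids A i \<omega>} \<inter> (X (Suc i) -` (- A) \<inter> space (Pr x)) \<in> past (space (Pr x)) X n"
      by (rule S.Int[OF Suc.IH[OF Suc_leD[OF Suc.prems]]])
    also have "{\<omega>\<in>space (Pr x). avoids A i \<omega>} \<inter> (X (Suc i) -` (- A) \<inter> space (Pr x)) =
        {\<omega>\<in>space (Pr x). avoids A (Suc i) \<omega>}"
      by (auto simp: avoids_Suc)
    finally show ?case .
  qed
  then show ?thesis by simp
qed

lemma avoids_measurable[measurable (raw)]:
  "A \<in> sets borel \<Longrightarrow> Measurable.pred (Pr x) (avoids A n)"
  using avoids_past[of A x n] past_subset_sets by (auto simp: pred_def)

text \<open>The transition operator of the chain killed on entering \<open>A\<close>; a start inside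
  \<open>A\<close> is allowed, as for the return time.\<close>

definition taboo :: "'a set \<Rightarrow> ('a \<Rightarrow> ennreal) \<Rightarrow> 'a \<Rightarrow> ennreal" where
  "taboo A g x = (\<integral>\<^sup>+y. indicator (- A) y * g y \<partial>step x)"

lemma taboo_measurable[measurable]:
  assumes [measurable]: "A \<in> sets borel" "g \<in> borel_measurable borel"
  shows "taboo A g \<in> borel_measurable borel"
  unfolding taboo_def[abs_def]
  by (rule nn_integral_measurable_subprob_algebra2[OF _ step_measurable]) measurable

text \<open>The Markov property integrates out the last step and turns \<open>g\<close> into
  \<open>taboo A g\<close>, which is why the induction generalises over \<open>g\<close>.\<close>

lemma nn_integral_avoids:
  assumes A[measurable]: "A \<in> sets borel" and "g \<in> borel_measurable borel"
  shows "(\<integral>\<^sup>+\<omega>. indicator {\<omega>\<in>space (Pr x). avoids A n \<omega>} \<omega> * g (X n \<omega>) \<partial>Pr x) = (taboo A ^^ n) g x"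
  using assms(2)
proof (induction n arbitrary: g)
  case 0
  interpret prob_space "Pr x" by (rule prob_space_Pr)
  have "(\<integral>\<^sup>+\<omega>. indicator {\<omega>\<in>space (Pr x). avoids A 0 \<omega>} \<omega> * g (X 0 \<omega>) \<partial>Pr x) = (\<integral>\<^sup>+\<omega>. g x \<partial>Pr x)"
    using X_0[of x] by (intro nn_integral_cong_AE) auto
  then show ?case by (simp add: emeasure_space_1)
next
  case (Suc n)
  note [measurable] = Suc.prems
  have "(\<integral>\<^sup>+\<omega>. indicator {\<omega>\<in>space (Pr x). avoids A (Suc n) \<omega>} \<omega> * g (X (Suc n) \<omega>) \<partial>Pr x) =
    (\<integral>\<^sup>+\<omega>. indicator {\<omega>\<in>space (Pr x). avoids A n \<omega>} \<omega> * (indicator (- A) (X (Suc n) \<omega>) * g (X (Suc n) \<omega>)) \<partial>Pr x)"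
    by (intro nn_integral_cong) (auto simp: avoids_Suc indicator_def)
  also have "\<dots> = (\<integral>\<^sup>+\<omega>. indicator {\<omega>\<in>space (Pr x). avoids A n \<omega>} \<omega> * taboo A g (X n \<omega>) \<partial>Pr x)"
    unfolding taboo_def by (rule markov_nn_integral[OF avoids_past]) auto
  also have "\<dots> = (taboo A ^^ n) (taboo A g) x"
    by (rule Suc.IH) measurable
  finally show ?case by (simp add: funpow_swap1)
qed

definition survival :: "'a set \<Rightarrow> nat \<Rightarrow> 'a \<Rightarrow> real" where
  "survival A n x = measure (Pr x) {\<omega>\<in>space (Pr x). avoids A n \<omega>}"

lemma ennreal_survival:
  "ennreal (survival A n x) = emeasure (Pr x) {\<omega>\<in>space (Pr x). avoids A n \<omega>}"
proof -
  interpret prob_space "Pr x" by (rule prob_space_Pr)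
  show ?thesis by (simp add: survival_def emeasure_eq_measure)
qed

lemma ennreal_survival_taboo:
  assumes [measurable]: "A \<in> sets borel"
  shows "ennreal (survival A n x) = (taboo A ^^ n) (\<lambda>_. 1) x"
  using nn_integral_avoids[OF assms, of "\<lambda>_. 1" x n]
  by (simp add: ennreal_survival)

lemma survival_nonneg[simp]: "0 \<le> survival A n x"
  by (simp add: survival_def)

lemma survival_le_1: "survival A n x \<le> 1"
  unfolding survival_def by (intro prob_space.prob_le_1 prob_space_Pr)

lemma survival_0[simp]: "survival A 0 x = 1"
  by (simp add: survival_def prob_space.prob_space prob_space_Pr)

text \<open>Measurability in the starting point comes from the taboo powers, which involve only the
  one-step kernel, rather than from the laws \<open>Pr x\<close>.\<close>

lemma survival_measurable[measurable]:
  assumes [measurable]: "A \<in> sets borel"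
  shows "survival A n \<in> borel_measurable borel"
proof -
  have "(taboo A ^^ n) (\<lambda>_. 1) \<in> borel_measurable borel"
    by (induction n) auto
  then have "(\<lambda>x. enn2real (ennreal (survival A n x))) \<in> borel_measurable borel"
    by (simp add: ennreal_survival_taboo)
  then show ?thesis by simp
qed

lemma integrable_step:
  fixes g :: "'a \<Rightarrow> real"
  assumes "g \<in> borel_measurable borel" "\<And>y. \<bar>g y\<bar> \<le> c"
  shows "integrable (step x) g"
proof -
  interpret prob_space "step x" by (rule prob_space_step)
  show ?thesis
    using assms by (intro integrable_const_bound[where B=c]) auto
qed

text \<open>First-step analysis: the outermost application in a power of \<open>taboo\<close> is the
  first step of the chain, whereas the Markov property was used on the last one.\<close>

lemma survival_Suc:
  assumes A[measurable]: "A \<in> sets borel"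
  shows "survival A (Suc n) x = (\<integral>y. indicator (- A) y * survival A n y \<partial>step x)"
proof -
  have "ennreal (survival A (Suc n) x) = taboo A ((taboo A ^^ n) (\<lambda>_. 1)) x"
    by (simp add: ennreal_survival_taboo)
  also have "(taboo A ^^ n) (\<lambda>_. 1) = (\<lambda>x. ennreal (survival A n x))"
    by (simp add: ennreal_survival_taboo)
  also have "taboo A \<dots> x = (\<integral>\<^sup>+y. ennreal (indicator (- A) y * survival A n y) \<partial>step x)"
    unfolding taboo_def by (simp add: ennreal_mult ennreal_indicator)
  also have "\<dots> = ennreal (\<integral>y. indicator (- A) y * survival A n y \<partial>step x)"
    by (intro nn_integral_eq_integral integrable_step[where c=1])
       (auto simp: indicator_def survival_le_1)
  finally show ?thesis
    by (subst (asm) ennreal_inj) (auto intro!: integral_nonneg)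
qed

lemma survival_antimono: "A \<in> sets borel \<Longrightarrow> m \<le> n \<Longrightarrow> survival A n x \<le> survival A m x"
  unfolding survival_def
  by (intro finite_measure.finite_measure_mono prob_space.finite_measure prob_space_Pr)
     (auto simp: avoids_def)

text \<open>The tail-sum formula before integration: \<open>avoids A n\<close> says that the return
  time exceeds \<open>n\<close>. Visits count from time 1 on both sides, so the term for
  \<open>n = 0\<close> is always 1; without a visit both sides are infinite.\<close>

lemma return_time_eq_suminf: "return_time X A \<omega> = (\<Sum>n. indicator {n. avoids A n \<omega>} n)"
proof (cases "\<exists>n\<ge>1. X n \<omega> \<in> A")
  case False
  then have "{n. n \<ge> 1 \<and> X n \<omega> \<in> A} = {}" "\<And>n. avoids A n \<omega>"
    by (auto simp: avoids_def)
  then show ?thesis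
    by (simp add: return_time_def flip: nn_integral_count_space_nat)
next
  case True
  define m where "m = (LEAST n. n \<ge> 1 \<and> X n \<omega> \<in> A)"
  have m: "m \<ge> 1" "X m \<omega> \<in> A"
    using LeastI_ex[OF True] by (auto simp: m_def)
  have least: "m \<le> n" if "n \<ge> 1" "X n \<omega> \<in> A" for n
    unfolding m_def using that by (intro Least_le) auto
  have "return_time X A \<omega> = of_nat m"
    unfolding return_time_def
    by (rule antisym) (use m least in \<open>auto intro!: INF_lower INF_greatest\<close>)
  moreover have "avoids A n \<omega> \<longleftrightarrow> n < m" for n
    using m least by (fastforce simp: avoids_def)
  then have "(\<Sum>n. indicator {n. avoids A n \<omega>} n :: ennreal) = (\<Sum>n<m. 1)"
    by (subst suminf_finite[of "{..<m}"]) auto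
  ultimately show ?thesis by simp
qed

lemma nn_integral_return_time:
  assumes [measurable]: "A \<in> sets borel"
  shows "(\<integral>\<^sup>+\<omega>. return_time X A \<omega> \<partial>Pr x) = (\<Sum>n. ennreal (survival A n x))"
proof -
  have "(\<integral>\<^sup>+\<omega>. return_time X A \<omega> \<partial>Pr x) =
    (\<integral>\<^sup>+\<omega>. (\<Sum>n. indicator {\<omega>\<in>space (Pr x). avoids A n \<omega>} \<omega>) \<partial>Pr x)"
    unfolding return_time_eq_suminf by (intro nn_integral_cong suminf_cong) (auto simp: indicator_def)
  also have "\<dots> = (\<Sum>n. \<integral>\<^sup>+\<omega>. indicator {\<omega>\<in>space (Pr x). avoids A n \<omega>} \<omega> \<partial>Pr x)"
    by (rule nn_integral_suminf) measurable
  finally show ?thesis by (simp add: ennreal_survival)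
qed

subsection \<open>Bounds for mean return times\<close>

text \<open>After surviving \<open>m\<close> steps the chain must survive \<open>N\<close> more from
  wherever it is, and \<open>q\<close> is uniform in that position. Repeated first-step analysis
  replaces the Markov property at time \<open>m\<close>.\<close>

lemma survival_add_le:
  assumes A[measurable]: "A \<in> sets borel" and q: "\<And>y. survival A N y \<le> q"
  shows "survival A (m + N) x \<le> q * survival A m x"
proof (induction m arbitrary: x)
  case 0
  then show ?case using q by simp
next
  case (Suc m)
  have "survival A (Suc m + N) x = (\<integral>y. indicator (- A) y * survival A (m + N) y \<partial>step x)"
    by (simp add: survival_Suc)
  also have "\<dots> \<le> (\<integral>y. q * (indicator (- A) y * survival A m y) \<partial>step x)"
    using Suc.IH
    by (intro integral_mono integrable_mult_right integrable_step[where c=1])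
       (auto simp: indicator_def survival_le_1)
  finally show ?case by (simp add: survival_Suc)
qed

text \<open>If S is the partial sum, the first \<open>N\<close> terms contribute at most
  \<open>N\<close> and the others at most q S, so S \<le> N + q S; finiteness of S allows solving
  for it.\<close>

lemma sum_survival_bound:
  assumes A: "A \<in> sets borel" and q: "\<And>y. survival A N y \<le> q" "q < 1"
  shows "(\<Sum>k<n. survival A k x) \<le> real N / (1 - q)"
proof -
  \<comment> \<open>With the range extended to \<open>N + n\<close>, the shifted part runs over the
    same \<open>n\<close> indices as the original sum.\<close>
  have "(\<Sum>k<n. survival A k x) \<le> (\<Sum>k<N + n. survival A k x)"
    by (intro sum_mono2) auto
  also have "\<dots> = (\<Sum>k<N. survival A k x) + (\<Sum>k<n. survival A (k + N) x)"
    by (induction n) (simp_all add: add.commute add.assoc)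
  also have "\<dots> \<le> (\<Sum>k<N. 1) + (\<Sum>k<n. q * survival A k x)"
    by (intro add_mono sum_mono survival_le_1 survival_add_le A q)
  finally have "(\<Sum>k<n. survival A k x) * (1 - q) \<le> real N"
    by (simp add: sum_distrib_left[symmetric] algebra_simps)
  then show ?thesis
    using q(2) by (simp add: pos_le_divide_eq)
qed

text \<open>Markov's inequality for the return time truncated at \<open>n\<close>, from the
  monotonicity of the tails.\<close>

lemma survival_le_sum:
  assumes "A \<in> sets borel"
  shows "real n * survival A n x \<le> (\<Sum>k<n. survival A k x)"
proof -
  have "(\<Sum>k<n. survival A n x) \<le> (\<Sum>k<n. survival A k x)"
    using assms by (intro sum_mono survival_antimono) auto
  then show ?thesis by simp
qed

text \<open>
  Iterating \<open>V \<le> 1 + P V\<close> up to the first visit to \<open>A\<close>; the remainder is controlled by the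
  upper bound \<open>M\<close>, so no integrability of the return time is needed.
\<close>

lemma subsolution_le_sum_survival:
  fixes V :: "'a \<Rightarrow> real"
  assumes A[measurable]: "A \<in> sets borel"
    and zero: "\<And>x. x \<in> A \<Longrightarrow> V x = 0" and bound: "\<And>x. x \<notin> A \<Longrightarrow> V x \<le> M"
    and int: "\<And>x. x \<notin> A \<Longrightarrow> integrable (step x) V"
    and sub: "\<And>x. x \<notin> A \<Longrightarrow> V x - 1 \<le> (\<integral>y. V y \<partial>step x)"
    and "x \<notin> A"
  shows "V x \<le> (\<Sum>k<n. survival A k x) + M * survival A n x"
  using \<open>x \<notin> A\<close>
proof (induction n arbitrary: x)
  case 0
  then show ?case using bound by simp
next
  case (Suc n)
  have i: "integrable (step x) (\<lambda>y. indicator (- A) y * survival A k y)" for k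
    by (intro integrable_step[where c=1]) (auto simp: indicator_def survival_le_1)
  have "V x \<le> 1 + (\<integral>y. V y \<partial>step x)"
    using sub[OF Suc.prems] by simp
  also have "(\<integral>y. V y \<partial>step x) \<le>
      (\<integral>y. (\<Sum>k<n. indicator (- A) y * survival A k y) + M * (indicator (- A) y * survival A n y) \<partial>step x)"
    using Suc.IH zero
    by (intro integral_mono int Suc.prems Bochner_Integration.integrable_add
        Bochner_Integration.integrable_sum integrable_mult_right i) (auto simp: indicator_def)
  also have "\<dots> = (\<Sum>k<n. survival A (Suc k) x) + M * survival A (Suc n) x"
    unfolding survival_Suc[OF A]
    by (subst Bochner_Integration.integral_add)
       (simp_all only: Bochner_Integration.integral_sum[OF i] integral_mult_right_zero
         Bochner_Integration.integrable_sum[OF i] integrable_mult_right[OF i])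
  finally show ?case
    by (simp add: sum.lessThan_Suc_shift del: sum.lessThan_Suc)
qed

text \<open>First-step analysis extends a bound outside \<open>A\<close> to all starting points, at
  the price of 1. Strong ergodicity concerns the supremum over the whole space.\<close>

lemma sum_survival_le_Suc:
  assumes A[measurable]: "A \<in> sets borel"
    and B: "\<And>y. y \<notin> A \<Longrightarrow> (\<Sum>k<n. survival A k y) \<le> B" "0 \<le> B"
  shows "(\<Sum>k<Suc n. survival A k x) \<le> 1 + B"
proof -
  interpret prob_space "step x" by (rule prob_space_step)
  have i: "integrable (step x) (\<lambda>y. indicator (- A) y * survival A k y)" for k
    by (intro integrable_step[where c=1]) (auto simp: indicator_def survival_le_1)
  have "(\<Sum>k<Suc n. survival A k x) = 1 + (\<integral>y. (\<Sum>k<n. indicator (- A) y * survival A k y) \<partial>step x)"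
    by (simp only: sum.lessThan_Suc_shift survival_0 survival_Suc[OF A]
        Bochner_Integration.integral_sum[OF i])
  also have "(\<integral>y. (\<Sum>k<n. indicator (- A) y * survival A k y) \<partial>step x) \<le> (\<integral>y. B \<partial>step x)"
    using B by (intro integral_mono Bochner_Integration.integrable_sum i) (auto simp: indicator_def)
  finally show ?thesis using prob_space by simp
qed

section \<open>Hitting a set of positive measure from a petite set\<close>

lemma one_minus_survival_le_sum:
  assumes [measurable]: "C \<in> sets borel"
  shows "1 - survival C M x \<le> (\<Sum>m\<in>{1..M}. measure (kern m x) C)"
proof -
  interpret prob_space "Pr x" by (rule prob_space_Pr)
  have "1 - survival C M x = prob (space (Pr x) - {\<omega>\<in>space (Pr x). avoids C M \<omega>})"
    unfolding survival_def by (subst prob_compl) auto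
  also have "space (Pr x) - {\<omega>\<in>space (Pr x). avoids C M \<omega>} = (\<Union>m\<in>{1..M}. X m -` C \<inter> space (Pr x))"
    by (auto simp: avoids_def)
  also have "prob \<dots> \<le> (\<Sum>m\<in>{1..M}. prob (X m -` C \<inter> space (Pr x)))"
    by (intro measure_UNION_le) auto
  also have "\<dots> = (\<Sum>m\<in>{1..M}. measure (kern m x) C)"
    unfolding n_step_kernel_def by (simp add: measure_distr)
  finally show ?thesis .
qed

lemma kern_le_one_minus_survival:
  assumes [measurable]: "A \<in> sets borel" and "1 \<le> k" "k \<le> K"
  shows "measure (kern k x) A \<le> 1 - survival A K x"
proof -
  interpret prob_space "Pr x" by (rule prob_space_Pr)
  have "measure (kern k x) A = prob (X k -` A \<inter> space (Pr x))"
    unfolding n_step_kernel_def by (simp add: measure_distr)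
  also have "\<dots> \<le> prob (space (Pr x) - {\<omega>\<in>space (Pr x). avoids A K \<omega>})"
    using assms(2,3) by (intro finite_measure_mono) (auto simp: avoids_def)
  also have "\<dots> = 1 - survival A K x"
    unfolding survival_def by (subst prob_compl) auto
  finally show ?thesis .
qed

text \<open>The shifted geometric law charges exactly the times n \<ge> 1, so a vanishing sampled
  probability would make every term of the irreducibility series vanish.\<close>

lemma sampled_pos:
  assumes "irreducibility_measure Pr X \<psi>" "A \<in> sets borel" "emeasure \<psi> A > 0"
  shows "emeasure (sampled (map_pmf Suc (geometric_pmf (1/2))) x) A > 0"
proof (rule ccontr)
  assume "\<not> ?thesis"
  then have "AE n in geometric_pmf (1/2). emeasure (kern (Suc n) x) A = 0"
    using assms(2) by (simp add: emeasure_sampled nn_integral_0_iff_AE)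
  then have "emeasure (kern (Suc n) x) A = 0" for n
    by (simp add: AE_measure_pmf_iff set_pmf_geometric)
  moreover have "(\<Sum>n. emeasure (kern (Suc n) x) A) > 0"
    using assms unfolding irreducibility_measure_def by blast
  ultimately show False by simp
qed

lemma petite_if_sampled_lower_bound:
  assumes "C \<in> sets borel" "sets \<nu> = sets borel" "emeasure \<nu> UNIV > 0"
    "\<And>x B. x \<in> C \<Longrightarrow> B \<in> sets borel \<Longrightarrow> emeasure \<nu> B \<le> emeasure (sampled a x) B"
  shows "petite Pr X C"
  unfolding petite_def using assms by (auto simp: emeasure_sampled_suminf intro!: exI[of _ a] exI[of _ \<nu>])

text \<open>From every point the sampled chain reaches \<open>A\<close> with positive probability.
  The minorizing measure charges some level set \<open>L k\<close>, on which this probability is at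
  least 1/(k+1), so the bound is uniform over \<open>C\<close>. Truncating the random time keeps
  half of it.\<close>

lemma petite_uniform_hitting:
  assumes "petite Pr X C" and irr: "irreducibility_measure Pr X \<psi>"
    and A[measurable]: "A \<in> sets borel" and A_pos: "emeasure \<psi> A > 0"
  obtains N d where "d > 0" "\<And>x. x \<in> C \<Longrightarrow> d \<le> (\<Sum>n\<le>N. measure (kern n x) A)"
proof -
  obtain a :: "nat pmf" and \<nu> :: "'a measure" where C: "C \<in> sets borel"
    and sets_\<nu>[measurable_cong]: "sets \<nu> = sets borel" and \<nu>_pos: "emeasure \<nu> UNIV > 0"
    and "\<forall>x\<in>C. \<forall>B\<in>sets borel. emeasure \<nu> B \<le> (\<Sum>n. ennreal (pmf a n) * emeasure (kern n x) B)"
    using assms(1) unfolding petite_def by auto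
  then have minor: "emeasure \<nu> B \<le> emeasure (sampled a x) B" if "x \<in> C" "B \<in> sets borel" for x B
    using that by (simp add: emeasure_sampled_suminf)
  define g where "g = map_pmf Suc (geometric_pmf (1/2))"
  define b where "b = conv_pmf a g"
  define L where "L k = {y. ennreal (1 / Suc k) \<le> emeasure (sampled g y) A}" for k :: nat
  have L[measurable]: "L k \<in> sets borel" for k
    unfolding L_def by measurable
  have "\<exists>k. y \<in> L k" for y
  proof -
    have "0 < emeasure (sampled g y) A"
      unfolding g_def by (rule sampled_pos[OF irr A A_pos])
    moreover have "emeasure (sampled g y) A \<noteq> \<infinity>"
      using subprob_space.emeasure_subprob_space_less_top[of "sampled g y" A]
        subprob_space_kernel[OF sampled_measurable, of y g] by auto
    ultimately obtain r where r: "emeasure (sampled g y) A = ennreal r" "r > 0"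
      by (cases "emeasure (sampled g y) A") auto
    obtain k where "inverse (real (Suc k)) < r" using reals_Archimedean[OF r(2)] by auto
    then show ?thesis
      using r by (auto simp: L_def inverse_eq_divide intro!: exI[of _ k] ennreal_leI)
  qed
  then have UN: "(\<Union>k. L k) = UNIV" by auto
  have "\<exists>k. emeasure \<nu> (L k) > 0"
  proof (rule ccontr)
    assume "\<not> ?thesis"
    then have "(\<Union>k. L k) \<in> null_sets \<nu>"
      by (intro null_sets_UN) (auto simp: null_sets_def sets_\<nu>)
    then show False using \<nu>_pos UN by auto
  qed
  then obtain k where k: "emeasure \<nu> (L k) > 0" by auto
  \<comment> \<open>The product can be infinite only if \<open>C\<close> is empty; the value 1
    serves in that case.\<close>
  obtain e where e: "e > 0" "ennreal e \<le> ennreal (1 / Suc k) * emeasure \<nu> (L k)"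
  proof (cases "ennreal (1 / Suc k) * emeasure \<nu> (L k)")
    case (real r)
    then show ?thesis using k that[of r] by (cases "r = 0") auto
  next
    case top
    then show ?thesis using that[of 1] by simp
  qed
  have lower: "ennreal e \<le> emeasure (sampled b x) A" if "x \<in> C" for x
  proof -
    have "ennreal e \<le> ennreal (1 / Suc k) * emeasure \<nu> (L k)" by (rule e)
    also have "\<dots> \<le> ennreal (1 / Suc k) * emeasure (sampled a x) (L k)"
      by (intro mult_left_mono minor that L) simp
    also have "\<dots> = (\<integral>\<^sup>+y. ennreal (1 / Suc k) * indicator (L k) y \<partial>sampled a x)"
      by (subst nn_integral_cmult_indicator) auto
    also have "\<dots> \<le> (\<integral>\<^sup>+y. emeasure (sampled g y) A \<partial>sampled a x)"
      by (intro nn_integral_mono) (auto simp: L_def indicator_def)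
    also have "\<dots> = emeasure (sampled b x) A"
      unfolding b_def by (rule nn_integral_emeasure_sampled) simp
    finally show ?thesis .
  qed
  have "(\<lambda>N. measure_pmf.prob b {..N}) \<longlonglongrightarrow> measure_pmf.prob b (\<Union>N. {..N})"
    by (intro measure_pmf.finite_Lim_measure_incseq) (auto simp: incseq_def)
  also have "measure_pmf.prob b (\<Union>N. {..N}) = 1"
    by (subst measure_pmf.prob_eq_1) auto
  finally have "\<forall>\<^sub>F N in sequentially. measure_pmf.prob b {..N} > 1 - e / 2"
    using e(1) by (intro order_tendstoD) auto
  then obtain N where N: "measure_pmf.prob b {..N} > 1 - e / 2"
    by (auto simp: eventually_sequentially)
  have tail: "measure_pmf.prob b (- {..N}) < e / 2"
    using N measure_pmf.prob_compl[of "{..N}" b] by (simp add: Compl_eq_Diff_UNIV)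
  have "e / 2 \<le> (\<Sum>n\<le>N. measure (kern n x) A)" if "x \<in> C" for x
  proof -
    have eq: "emeasure (kern n x) A = ennreal (measure (kern n x) A)" for n
      by (intro finite_measure.emeasure_eq_measure prob_space.finite_measure prob_space_kern)
    have "ennreal e \<le> (\<integral>\<^sup>+n. emeasure (kern n x) A \<partial>measure_pmf b)"
      using lower[OF that] by (simp add: emeasure_sampled)
    \<comment> \<open>A time up to \<open>N\<close> contributes at most the full sum, a later one at
      most 1, and later times have \<open>b\<close>-probability below e/2.\<close>
    also have "\<dots> \<le> (\<integral>\<^sup>+n. ennreal (\<Sum>n\<le>N. measure (kern n x) A) + indicator (- {..N}) n \<partial>measure_pmf b)"
    proof (rule nn_integral_mono)
      fix n
      show "emeasure (kern n x) A \<le> ennreal (\<Sum>n\<le>N. measure (kern n x) A) + indicator (- {..N}) n"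
      proof (cases "n \<le> N")
        case True
        then have "measure (kern n x) A \<le> (\<Sum>n\<le>N. measure (kern n x) A)"
          by (intro member_le_sum) auto
        then show ?thesis using True by (simp add: eq ennreal_leI)
      next
        case False
        then show ?thesis
          using prob_space.emeasure_le_1[OF prob_space_kern, of n x A] by (simp add: add_increasing)
      qed
    qed
    also have "\<dots> = ennreal (\<Sum>n\<le>N. measure (kern n x) A) + emeasure b (- {..N})"
      by (subst nn_integral_add) (auto simp: measure_pmf.emeasure_space_1[simplified])
    also have "emeasure b (- {..N}) = ennreal (measure_pmf.prob b (- {..N}))"
      by (rule measure_pmf.emeasure_eq_measure)
    finally have "e \<le> (\<Sum>n\<le>N. measure (kern n x) A) + measure_pmf.prob b (- {..N})"
      by (simp add: sum_nonneg flip: ennreal_plus)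
    then show ?thesis using tail by simp
  qed
  then show thesis
    using e(1) that[of "e / 2" N] by simp
qed

text \<open>Chapman-Kolmogorov at time \<open>m\<close>, keeping only the paths that are then in
  \<open>C\<close>.\<close>

lemma hitting_add_lower:
  assumes [measurable]: "A \<in> sets borel" "C \<in> sets borel"
    and d: "d \<ge> 0" "\<And>y. y \<in> C \<Longrightarrow> d \<le> (\<Sum>n\<le>N. measure (kern n y) A)"
  shows "d * measure (kern m x) C \<le> (\<Sum>n\<le>N. measure (kern (m + n) x) A)"
proof -
  have eq: "emeasure (kern n y) B = ennreal (measure (kern n y) B)" for n y B
    by (intro finite_measure.emeasure_eq_measure prob_space.finite_measure prob_space_kern)
  have "ennreal (d * measure (kern m x) C) = (\<integral>\<^sup>+y. ennreal d * indicator C y \<partial>kern m x)"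
    using d(1) by (subst nn_integral_cmult_indicator) (auto simp: eq ennreal_mult)
  also have "\<dots> \<le> (\<integral>\<^sup>+y. (\<Sum>n\<le>N. emeasure (kern n y) A) \<partial>kern m x)"
    using d(2) by (intro nn_integral_mono) (auto simp: eq indicator_def sum_ennreal intro!: ennreal_leI)
  also have "\<dots> = (\<Sum>n\<le>N. emeasure (kern (m + n) x) A)"
    by (subst nn_integral_sum) (auto simp: emeasure_kern_add)
  also have "\<dots> = ennreal (\<Sum>n\<le>N. measure (kern (m + n) x) A)"
    by (simp add: eq sum_ennreal)
  finally show ?thesis
    by (simp add: sum_nonneg)
qed

text \<open>A bounded mean return time forces a visit to \<open>C\<close> by a fixed time
  \<open>M\<close> with probability at least 1/2; \<open>petite_uniform_hitting\<close> then leads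
  from \<open>C\<close> to \<open>A\<close> in at most \<open>N\<close> further steps.\<close>

lemma strongly_ergodic_uniform_survival:
  assumes "strongly_ergodic Pr X" and irr: "irreducibility_measure Pr X \<psi>"
    and A[measurable]: "A \<in> sets borel" and A_pos: "emeasure \<psi> A > 0"
  obtains K q where "q < 1" "\<And>x. survival A K x \<le> q"
proof -
  obtain C where C: "petite Pr X C" and fin: "(SUP x. \<integral>\<^sup>+\<omega>. return_time X C \<omega> \<partial>Pr x) < \<infinity>"
    using assms(1) unfolding strongly_ergodic_def by auto
  have C_meas[measurable]: "C \<in> sets borel" using C by (simp add: petite_def)
  obtain t where t: "(SUP x. \<integral>\<^sup>+\<omega>. return_time X C \<omega> \<partial>Pr x) = ennreal t" "t \<ge> 0"
    using fin by (cases "SUP x. \<integral>\<^sup>+\<omega>. return_time X C \<omega> \<partial>Pr x") auto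
  have sum_le: "(\<Sum>k<n. survival C k x) \<le> t" for n x
  proof -
    have "ennreal (\<Sum>k<n. survival C k x) = (\<Sum>k<n. ennreal (survival C k x))"
      by (simp add: sum_ennreal)
    also have "\<dots> \<le> (\<Sum>k. ennreal (survival C k x))"
      by (rule sum_le_suminf) auto
    also have "\<dots> \<le> ennreal t"
      unfolding nn_integral_return_time[OF C_meas, symmetric] t(1)[symmetric] by (rule SUP_upper) simp
    finally show ?thesis using t(2) by simp
  qed
  \<comment> \<open>Taking \<open>M\<close> above twice the mean bound yields survival probability
    at most 1/2 by Markov's inequality.\<close>
  obtain M :: nat where M: "2 * t < real M" using reals_Archimedean2 by blast
  have half: "survival C M x \<le> 1/2" for x
  proof -
    have "real M * survival C M x \<le> real M * (1/2)"
      using survival_le_sum[OF C_meas, of M x] sum_le[of x M] M by simp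
    moreover have "real M > 0" using M t(2) by linarith
    ultimately show ?thesis by (simp only: mult_le_cancel_left_pos)
  qed
  obtain N d where d: "d > 0" "\<And>x. x \<in> C \<Longrightarrow> d \<le> (\<Sum>n\<le>N. measure (kern n x) A)"
    using petite_uniform_hitting[OF C irr A A_pos] by metis
  \<comment> \<open>\<open>J\<close> counts the pairs (m, n) with 1 \<le> m \<le> M and n \<le> N.
    Each time m + n lies between 1 and M + N, so a visit to \<open>A\<close> at that time excludes
    survival up to M + N.\<close>
  define J where "J = real M * real (Suc N)"
  have M_pos: "M > 0" using M t(2) by (cases M) auto
  have J: "J > 0" using M_pos by (simp add: J_def)
  have "survival A (M + N) x \<le> 1 - d / (2 * J)" for x
  proof -
    have "d * (1/2) \<le> d * (1 - survival C M x)"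
      using d(1) half[of x] by (intro mult_left_mono) auto
    also have "\<dots> \<le> d * (\<Sum>m\<in>{1..M}. measure (kern m x) C)"
      using d(1) by (intro mult_left_mono one_minus_survival_le_sum) auto
    also have "\<dots> \<le> (\<Sum>m\<in>{1..M}. \<Sum>n\<le>N. measure (kern (m + n) x) A)"
      unfolding sum_distrib_left using d by (intro sum_mono hitting_add_lower) auto
    also have "\<dots> \<le> (\<Sum>m\<in>{1..M}. \<Sum>n\<le>N. 1 - survival A (M + N) x)"
      by (intro sum_mono kern_le_one_minus_survival) auto
    also have "\<dots> = J * (1 - survival A (M + N) x)"
      by (simp add: J_def)
    finally have "d / (2 * J) \<le> 1 - survival A (M + N) x"
      using J by (simp add: field_simps)
    then show ?thesis by simp
  qed
  moreover have "1 - d / (2 * J) < 1" using d(1) J by simp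
  ultimately show thesis using that by blast
qed

end

subsection \<open>Existence of petite sets\<close>

text \<open>Sigma-finiteness gives a strictly positive integrable function, and positive total mass
  lets it be normalised to a probability density.\<close>

lemma (in sigma_finite_measure) obtain_equivalent_prob_space:
  assumes "emeasure M (space M) > 0"
  obtains N where "prob_space N" "sets N = sets M" "absolutely_continuous M N"
proof -
  obtain h where h[measurable]: "h \<in> borel_measurable M" and fin: "(\<integral>\<^sup>+x. h x \<partial>M) \<noteq> \<infinity>"
    and pos: "\<And>x. x \<in> space M \<Longrightarrow> 0 < h x"
    using Ex_finite_integrable_function by auto
  define c where "c = (\<integral>\<^sup>+x. h x \<partial>M)"
  have "c \<noteq> 0"
  proof
    assume "c = 0"
    then have "AE x in M. h x = 0" by (simp add: c_def nn_integral_0_iff_AE)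
    moreover have "AE x in M. h x \<noteq> 0" using pos by (intro AE_I2) force
    ultimately have "AE x in M. False" by eventually_elim simp
    then show False using assms by (simp add: AE_iff_measurable[of "space M"])
  qed
  define N where "N = density M (\<lambda>x. h x / c)"
  have "prob_space N"
  proof (rule prob_spaceI)
    have "emeasure N (space N) = (\<integral>\<^sup>+x. h x / c \<partial>M)"
      unfolding N_def by (simp add: emeasure_density cong: nn_integral_cong)
    also have "\<dots> = c / c"
      unfolding c_def by (rule nn_integral_divide) simp
    finally show "emeasure N (space N) = 1"
      using fin \<open>c \<noteq> 0\<close> by (simp add: c_def ennreal_divide_self top.not_eq_extremum)
  qed
  moreover have "absolutely_continuous M N"
    unfolding N_def by (rule absolutely_continuousI_density) simp
  ultimately show thesis using that by (simp add: N_def)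
qed

text \<open>By irreducibility a null set of the sampled kernel at any point is \<psi>-null, hence
  null for a probability measure \<phi> absolutely continuous with respect to \<psi>. The two-step
  minorization applies to \<phi>, and its two steps merge into one sampling law.\<close>

lemma ex_petite_positive_set:
  fixes Pr :: "'a::second_countable_topology \<Rightarrow> 'w measure"
  assumes "markov_chain Pr X" and irr: "irreducibility_measure Pr X \<psi>" and "emeasure \<psi> UNIV > 0"
  obtains C where "C \<in> positive_sets \<psi>" "petite Pr X C"
proof -
  interpret markov_process Pr X by unfold_locales fact
  have sets_\<psi>: "sets \<psi> = sets borel" and "sigma_finite_measure \<psi>"
    using irr by (auto simp: irreducibility_measure_def)
  then interpret sigma_finite_measure \<psi> by simp
  have "emeasure \<psi> (space \<psi>) > 0"
    using assms(3) sets_eq_imp_space_eq[OF sets_\<psi>] by simp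
  then obtain \<phi> where \<phi>: "prob_space \<phi>" "sets \<phi> = sets \<psi>" and ac: "absolutely_continuous \<psi> \<phi>"
    by (rule obtain_equivalent_prob_space)
  have sets_\<phi>[measurable_cong]: "sets \<phi> = sets borel" using \<phi>(2) sets_\<psi> by simp
  define g where "g = map_pmf Suc (geometric_pmf (1/2))"
  have ac_sampled: "absolutely_continuous (sampled g x) \<phi>" for x
    unfolding absolutely_continuous_def
  proof
    fix B assume B: "B \<in> null_sets (sampled g x)"
    then have "emeasure \<psi> B = 0"
      using sampled_pos[OF irr, of B x]
      by (cases "emeasure \<psi> B = 0") (auto simp: g_def null_sets_def zero_less_iff_neq_zero)
    then have "B \<in> null_sets \<psi>" using B by (auto simp: null_sets_def sets_\<psi>)
    then show "B \<in> null_sets \<phi>" using ac by (auto simp: absolutely_continuous_def)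
  qed
  obtain C D :: "'a set" and c :: real where
    C: "C \<in> sets borel" "emeasure \<phi> C > 0" and D: "D \<in> sets borel" "emeasure \<phi> D > 0" and "c > 0"
    and minor: "\<And>x B. x \<in> C \<Longrightarrow> B \<in> sets borel \<Longrightarrow>
      ennreal c * emeasure \<phi> (B \<inter> D) \<le> emeasure (sampled g x \<bind> sampled g) B"
    by (rule two_step_minorization[OF \<phi>(1) sets_\<phi> sampled_measurable ac_sampled], rule that)
  define \<nu> where "\<nu> = scale_measure (ennreal c) (density \<phi> (indicator D))"
  have \<nu>: "emeasure \<nu> B = ennreal c * emeasure \<phi> (B \<inter> D)" if "B \<in> sets borel" for B
    using that D(1) unfolding \<nu>_def
    by (simp add: emeasure_density sets_\<phi> Int_commute nn_integral_indicator indicator_inter_arith[symmetric])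
  have "petite Pr X C"
  proof (rule petite_if_sampled_lower_bound[OF C(1)])
    show "sets \<nu> = sets borel" by (simp add: \<nu>_def sets_\<phi>)
    show "emeasure \<nu> UNIV > 0" using D(2) \<open>c > 0\<close> by (simp add: \<nu> ennreal_zero_less_mult_iff)
    fix x :: 'a and B :: "'a set" assume "x \<in> C" and B: "B \<in> sets borel"
    have "emeasure (sampled g x \<bind> sampled g) B = emeasure (sampled (conv_pmf g g) x) B"
      using B nn_integral_emeasure_sampled[OF B, of g x g]
      by (simp add: emeasure_bind[where N=borel])
    then show "emeasure \<nu> B \<le> emeasure (sampled (conv_pmf g g) x) B"
      using minor[OF \<open>x \<in> C\<close> B] \<nu>[OF B] by simp
  qed
  \<comment> \<open>Positivity passes from \<phi> to \<psi>, since \<psi>-null sets are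
    \<phi>-null.\<close>
  moreover have "emeasure \<psi> C > 0"
  proof (rule ccontr)
    assume "\<not> emeasure \<psi> C > 0"
    then have "C \<in> null_sets \<phi>"
      using ac C(1) by (auto simp: absolutely_continuous_def null_sets_def sets_\<psi>)
    then show False using C(2) by auto
  qed
  ultimately show thesis
    using C(1) that by (simp add: positive_sets_def)
qed

theorem theorem1p4:
  fixes Pr :: "'a::{metric_space, second_countable_topology} \<Rightarrow> 'w measure"
    and X :: "nat \<Rightarrow> 'w \<Rightarrow> 'a"
    and \<psi> :: "'a measure"
  assumes "locally_compact_space (euclidean :: 'a topology)"
    and "markov_chain Pr X"
    and "maximal_irreducibility_measure Pr X \<psi>"
    and "harris_recurrent Pr X \<psi>"
    and "aperiodic Pr X \<psi>"
    and "feller Pr X"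
    and "interior (measure_support \<psi>) \<noteq> {}"
  shows "\<not> strongly_ergodic Pr X \<longleftrightarrow>
    (\<exists>A\<in>positive_sets \<psi>. \<exists>V :: nat \<Rightarrow> 'a \<Rightarrow> real.
      (\<forall>n\<ge>1. V n \<in> borel_measurable borel) \<and>
      (\<forall>n\<ge>1. (SUP x\<in>- A. ereal (V n x)) < \<infinity> \<and> (\<forall>x\<in>A. V n x = 0)) \<and>
      (\<forall>n\<ge>1. \<forall>x\<in>- A. integrable (n_step_kernel Pr X 1 x) (V n) \<and>
        (\<integral>y. V n y \<partial>n_step_kernel Pr X 1 x) \<ge> V n x - 1) \<and>
      (SUP (n, x)\<in>{1..} \<times> - A. ereal (V n x)) = \<infinity>)"
proof -
  interpret markov_process Pr X by unfold_locales fact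
  have irr: "irreducibility_measure Pr X \<psi>"
    using assms(3) by (simp add: maximal_irreducibility_measure_def)
  \<comment> \<open>A natural bound is nonnegative, which matters when the remainder is multiplied
    by it, and it also covers the supremum over an empty set.\<close>
  have upper: "\<exists>m::nat. \<forall>i\<in>I. f i \<le> real m" if fin: "(SUP i\<in>I. ereal (f i)) \<noteq> \<infinity>" for I :: "'i set" and f
  proof -
    obtain m :: nat where "(SUP i\<in>I. ereal (f i)) \<le> ereal (real m)"
      using fin unfolding less_PInf_Ex_of_nat by (blast intro: less_imp_le)
    then show ?thesis by (auto simp: SUP_le_iff)
  qed
  show ?thesis
  proof
    assume not_ergodic: "\<not> strongly_ergodic Pr X"
    obtain z where "z \<in> measure_support \<psi>"
      using assms(7) interior_subset by blast
    then have "emeasure \<psi> UNIV > 0"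
      by (auto simp: measure_support_def)
    then obtain C where C_pos: "C \<in> positive_sets \<psi>" and petite: "petite Pr X C"
      using ex_petite_positive_set[OF assms(2) irr] by blast
    have C[measurable]: "C \<in> sets borel" using petite by (simp add: petite_def)
    \<comment> \<open>Off \<open>C\<close> this is the mean return time truncated at
      \<open>n\<close>, by the tail-sum formula; condition (1) dictates the value 0 on
      \<open>C\<close>.\<close>
    define V where "V n x = indicator (- C) x * (\<Sum>k<n. survival C k x)" for n :: nat and x
    have V_meas[measurable]: "V n \<in> borel_measurable borel" for n
      unfolding V_def[abs_def] by measurable
    have sum_le: "(\<Sum>k<n. survival C k x) \<le> real n" for n x
      using sum_mono[of "{..<n}" "\<lambda>k. survival C k x" "\<lambda>_. 1"] by (simp add: survival_le_1)
    have V_le: "\<bar>V n x\<bar> \<le> real n" for n x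
      using sum_le[of x n] by (auto simp: V_def indicator_def sum_nonneg)
    have step_V: "(\<integral>y. V n y \<partial>step x) = (\<Sum>k<n. survival C (Suc k) x)" for n x
    proof -
      have i: "integrable (step x) (\<lambda>y. indicator (- C) y * survival C k y)" for k
        by (intro integrable_step[where c=1]) (auto simp: indicator_def survival_le_1)
      show ?thesis
        unfolding V_def sum_distrib_left survival_Suc[OF C] by (rule Bochner_Integration.integral_sum[OF i])
    qed
    have "V n x - 1 \<le> (\<integral>y. V n y \<partial>step x)" for n x
    proof -
      have "V n x \<le> (\<Sum>k<n. survival C k x)"
        by (auto simp: V_def indicator_def sum_nonneg)
      \<comment> \<open>With one more nonnegative term, the sum is 1 plus \<open>n\<close> shifted
        tails, and those are one step applied to \<open>V n\<close>.\<close>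
      also have "\<dots> \<le> (\<Sum>k<Suc n. survival C k x)" by simp
      also have "\<dots> = 1 + (\<integral>y. V n y \<partial>step x)"
        by (simp only: sum.lessThan_Suc_shift survival_0 step_V)
      finally show ?thesis by simp
    qed
    moreover have "V n x = 0" if "x \<in> C" for n x
      using that by (simp add: V_def)
    moreover have "integrable (step x) (V n)" for n x
      using V_le by (intro integrable_step) auto
    moreover have "(SUP x\<in>- C. ereal (V n x)) < \<infinity>" for n
    proof -
      have "V n x \<le> real n" for x using V_le[of n x] by simp
      then have "(SUP x\<in>- C. ereal (V n x)) \<le> ereal (real n)" by (intro SUP_least) simp
      then show ?thesis by (rule le_less_trans) simp
    qed
    moreover have "(SUP (n, x)\<in>{1..} \<times> - C. ereal (V n x)) = \<infinity>"
    proof (rule ccontr)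
      assume "\<not> ?thesis"
      then obtain m :: nat where "\<forall>(n, x)\<in>{1..} \<times> - C. V n x \<le> real m"
        using upper[of "\<lambda>(n, x). V n x" "{1..} \<times> - C"] by (auto simp: case_prod_beta')
      \<comment> \<open>The index 0 lies outside the range of the supremum, but its sum is
        empty.\<close>
      then have m: "(\<Sum>k<n. survival C k y) \<le> real m" if "y \<notin> C" for n y
        using that by (cases "n = 0") (auto simp: V_def)
      have "(\<integral>\<^sup>+\<omega>. return_time X C \<omega> \<partial>Pr x) \<le> ennreal (1 + real m)" for x
        unfolding nn_integral_return_time[OF C]
      proof (rule suminf_le_const)
        fix n
        have "(\<Sum>k<n. survival C k x) \<le> (\<Sum>k<Suc n. survival C k x)" by simp
        also have "\<dots> \<le> 1 + real m" by (rule sum_survival_le_Suc[OF C m]) auto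
        finally show "(\<Sum>k<n. ennreal (survival C k x)) \<le> ennreal (1 + real m)"
          by (simp add: sum_ennreal ennreal_leI del: ennreal_plus ennreal_1)
      qed simp
      then have "(SUP x. \<integral>\<^sup>+\<omega>. return_time X C \<omega> \<partial>Pr x) \<le> ennreal (1 + real m)"
        by (rule SUP_least)
      then have "(SUP x. \<integral>\<^sup>+\<omega>. return_time X C \<omega> \<partial>Pr x) < \<infinity>"
        by (rule le_less_trans) simp
      then show False
        using not_ergodic petite by (auto simp: strongly_ergodic_def)
    qed
    ultimately show "\<exists>A\<in>positive_sets \<psi>. \<exists>V :: nat \<Rightarrow> 'a \<Rightarrow> real.
      (\<forall>n\<ge>1. V n \<in> borel_measurable borel) \<and>
      (\<forall>n\<ge>1. (SUP x\<in>- A. ereal (V n x)) < \<infinity> \<and> (\<forall>x\<in>A. V n x = 0)) \<and>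
      (\<forall>n\<ge>1. \<forall>x\<in>- A. integrable (n_step_kernel Pr X 1 x) (V n) \<and>
        (\<integral>y. V n y \<partial>n_step_kernel Pr X 1 x) \<ge> V n x - 1) \<and>
      (SUP (n, x)\<in>{1..} \<times> - A. ereal (V n x)) = \<infinity>"
      unfolding step_def[symmetric] using C_pos V_meas
      by (intro bexI[of _ C] exI[of _ V]) auto
  next
    assume "\<exists>A\<in>positive_sets \<psi>. \<exists>V :: nat \<Rightarrow> 'a \<Rightarrow> real.
      (\<forall>n\<ge>1. V n \<in> borel_measurable borel) \<and>
      (\<forall>n\<ge>1. (SUP x\<in>- A. ereal (V n x)) < \<infinity> \<and> (\<forall>x\<in>A. V n x = 0)) \<and>
      (\<forall>n\<ge>1. \<forall>x\<in>- A. integrable (n_step_kernel Pr X 1 x) (V n) \<and>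
        (\<integral>y. V n y \<partial>n_step_kernel Pr X 1 x) \<ge> V n x - 1) \<and>
      (SUP (n, x)\<in>{1..} \<times> - A. ereal (V n x)) = \<infinity>"
    then obtain A and V :: "nat \<Rightarrow> 'a \<Rightarrow> real" where A_pos: "A \<in> positive_sets \<psi>"
      and V: "\<forall>n\<ge>1. (SUP x\<in>- A. ereal (V n x)) < \<infinity> \<and> (\<forall>x\<in>A. V n x = 0)"
        "\<forall>n\<ge>1. \<forall>x\<in>- A. integrable (step x) (V n) \<and> (\<integral>y. V n y \<partial>step x) \<ge> V n x - 1"
      and unbounded: "(SUP (n, x)\<in>{1..} \<times> - A. ereal (V n x)) = \<infinity>"
      unfolding step_def[symmetric] by blast
    have bound: "(SUP x\<in>- A. ereal (V n x)) \<noteq> \<infinity>"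
      and zero: "x \<in> A \<Longrightarrow> V n x = 0"
      and int: "x \<notin> A \<Longrightarrow> integrable (step x) (V n)"
      and sub: "x \<notin> A \<Longrightarrow> V n x - 1 \<le> (\<integral>y. V n y \<partial>step x)"
      if "n \<ge> 1" for n x
      using V that by auto
    have A: "A \<in> sets borel" "emeasure \<psi> A > 0"
      using A_pos by (auto simp: positive_sets_def)
    show "\<not> strongly_ergodic Pr X"
    proof
      assume "strongly_ergodic Pr X"
      then obtain K q where q: "q < 1" "\<And>x. survival A K x \<le> q"
        using strongly_ergodic_uniform_survival[OF _ irr A] by metis
      define B where "B = real K / (1 - q)"
      have B: "(\<Sum>k<j. survival A k x) \<le> B" for j x
        unfolding B_def by (rule sum_survival_bound[OF A(1) q(2,1)])
      have "V n x \<le> B + 1" if n: "n \<ge> 1" and x: "x \<notin> A" for n x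
      proof -
        obtain m :: nat where m: "\<forall>x\<in>- A. V n x \<le> real m"
          using upper[of "V n" "- A"] bound[OF n] by blast
        \<comment> \<open>\<open>j\<close> may depend on \<open>n\<close> through \<open>m\<close>:
          it only has to make the remainder at most 1, while \<open>B\<close> bounds the partial
          sums for every \<open>j\<close>. Thus B + 1 is uniform in \<open>n\<close>.\<close>
        obtain j :: nat where j: "real m * B < real j" "j > 0"
          using reals_Archimedean2[of "max 0 (real m * B)"] by auto
        have "V n x \<le> (\<Sum>k<j. survival A k x) + real m * survival A j x"
          using m by (intro subsolution_le_sum_survival A zero int sub n x) auto
        \<comment> \<open>The tail at \<open>j\<close> is at most B/j, because \<open>j\<close>
          decreasing tails sum to at most \<open>B\<close>.\<close>
        also have "real m * survival A j x \<le> 1"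
        proof -
          have "real j * (real m * survival A j x) = real m * (real j * survival A j x)" by simp
          also have "\<dots> \<le> real m * B"
            by (intro mult_left_mono order.trans[OF survival_le_sum[OF A(1)] B]) simp
          also have "\<dots> \<le> real j * 1" using j by simp
          finally show ?thesis using j(2) by (simp only: mult_le_cancel_left_pos of_nat_0_less_iff)
        qed
        finally show ?thesis using B[of x j] by simp
      qed
      then have "(SUP (n, x)\<in>{1..} \<times> - A. ereal (V n x)) \<le> ereal (B + 1)"
        by (intro SUP_least) auto
      then show False using unbounded by simp
    qed
  qed
qed

end
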